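(* Let $L_0$ be an even positive definite lattice of rank $n-2$, $n\ge3$, with quadratic form $q_{L_0}$, bilinear form $(\cdot,\cdot)_{L_0}$ and dual $L_0^\#$; let $L=U\oplus U\oplus(-1)L_0$. Let $F$ be a weakly holomorphic vector valued modular form of weight $(2-n)/2$ and type $\rho_L$ with integral Fourier coefficients $f(b,m)$, fix rational vectors $w_1,\dots,w_{n-2}$ forming a basis of $L_0\otimes\mathbb{R}$ (defining the relation $\succ$ and a corresponding Weyl chamber $W$), and let $\widetilde\Phi_F$, its powers $\widetilde\Phi_F^l$, the Weyl vector $[a_W,b_W,c_W]$ and $W_F$ be as in the context. Then: (1) The formal exponential $\widetilde\Psi_F:=W_F\exp(\widetilde\Phi_F)=W_F\sum_{l=0}^\infty\frac{1}{l!}\widetilde\Phi_F^l$ is well defined, in the sense that for each $[a,b,c]\in\mathcal{Q}$ the coefficient of $e^{[a,b,c]}$ in $\widetilde\Phi_F^l$ is nonzero for only finitely many $l$. (2) For every index $[a,b,c]$, the coefficient of $e^{[a,b,c]}$ in $\widetilde\Psi_F$ equals the Fourier coefficient of $e\big(a\tau+c\tau'-(b,z)_{L_0}\big)$ in the expansion of the Borcherds product $$\Psi_F=W_F\prod_{[a,b,c]\succ0}\big(1-e(a\tau+c\tau'-(b,z)_{L_0})\big)^{f(b,\mathrm{disc}([a,b,c]))}$$ on the domain where $(\Im\tau,\Im\tau',\Im z)\in W$.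
   Context: $U$ is the unimodular hyperbolic plane, $e(x)=\exp(2\pi i x)$. $\mathcal{Q}$ is the monoid of triples $[a,b,c]$, $a,c\in\mathbb{Z}$, $b\in L_0^\#$, with $\mathrm{disc}([a,b,c])=ac-q_{L_0}(b)$. The components $F_{\overline\lambda}$, $\overline\lambda\in L^\#/L\cong L_0^\#/L_0$, of $F$ have expansions $\sum_{m\gg-\infty}f(\overline\lambda,m)e(m\tau)$, and $f(b,m):=f(\overline b,m)$ for $b\in L_0^\#$. Write $b\succ0$ if there is $j$ with $(b,w_j)_{L_0}>0$ and $(b,w_{j'})_{L_0}=0$ for $j'<j$; $[a,b,c]\succ0$ if $c>0$, or $c=0,a>0$, or $a=c=0,b\succ0$. $W\subset\mathbb{R}\times\mathbb{R}\times(L_0\otimes\mathbb{R})$ is a Weyl chamber (in Borcherds' sense) such that $ay_1+cy_2-(b,y)_{L_0}>0$ for all $[a,b,c]\succ0$ and $(y_1,y_2,y)\in W$; by Borcherds' theorem the product defining $\Psi_F$ converges absolutely and locally uniformly for $(\Im\tau,\Im\tau',\Im z)\in W$. Elements of $\overline{\mathbb{Q}}[[\mathcal{Q}]]$ are formal sums $\sum g([a,b,c])e^{[a,b,c]}$ over $\mathcal{Q}$. $\widetilde\Phi_F:=-\sum_{[a,b,c]\succ0}f(b,\mathrm{disc}([a,b,c]))\sum_{m\ge1}e^{m[a,b,c]}/m$, with coefficients $\widetilde\phi_F$; its $l$-th power is $\widetilde\Phi_F^l=\sum_{[a,b,c]}\big(\sum_{[a_1,b_1,c_1]+\dots+[a_l,b_l,c_l]=[a,b,c]}\prod_i\widetilde\phi_F([a_i,b_i,c_i])\big)e^{[a,b,c]}$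 (inner sums finite), with $\widetilde\Phi_F^0=e^{[0,0,0]}$. Weyl vector: $a_W=\frac1{24}\sum_{b\in L_0^\#}f(b,-q_{L_0}(b))$, $b_W=-\frac12\sum_{0\prec b\in L_0^\#}f(b,-q_{L_0}(b))\,b$, $c_W=a_W-\sum_{n\ge1}\sigma_1(n)\sum_{b\in L_0^\#}f(b,-n-q_{L_0}(b))$, and $W_F=e(a_W\tau+c_W\tau'-(b_W,z)_{L_0})$; in the formal setting multiplication by $W_F$ means multiplication by $e^{[a_W,b_W,c_W]}$, i.e. shifting all indices by $[a_W,b_W,c_W]$.
   Formalization: Positivity on W is required only for [a,b,c]≻0 with f(b,disc)≠0 (for all [a,b,c]≻0 no W exists), and the expansion is asserted at all points over W where the product converges absolutely, proved to include those with large q(Im); convergence on all of W fails in general. *)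

theory Defs
  imports "HOL-Analysis.Analysis"
begin

definition ee :: "complex \<Rightarrow> complex" where
  "ee x = exp (2 * of_real pi * \<i> * x)"

definition upper_half_plane :: "complex set" where
  "upper_half_plane = {\<tau>. Im \<tau> > 0}"


section \<open>Lattices and discriminant groups\<close>

text \<open>Lattices of full rank in a Euclidean space. A positive definite lattice together with its
  real quadratic space is modelled by such a subset, with the ambient inner product as
  bilinear form.\<close>

definition is_lattice :: "'a::euclidean_space set \<Rightarrow> bool" where
  "is_lattice L \<longleftrightarrow> (\<exists>B. independent B \<and> span B = UNIV \<and>
     L = {v. \<exists>k :: 'a \<Rightarrow> int. v = (\<Sum>b\<in>B. of_int (k b) *\<^sub>R b)})"

definition quad :: "('v \<Rightarrow> 'v \<Rightarrow> real) \<Rightarrow> 'v \<Rightarrow> real" where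
  "quad B x = B x x / 2"

definition even_posdef_lattice :: "'a::euclidean_space set \<Rightarrow> bool" where
  "even_posdef_lattice L \<longleftrightarrow> is_lattice L \<and> (\<forall>x\<in>L. quad inner x \<in> \<int>)"

definition dual_lattice :: "('v \<Rightarrow> 'v \<Rightarrow> real) \<Rightarrow> 'v set \<Rightarrow> 'v set" where
  "dual_lattice B L = {x. \<forall>y\<in>L. B x y \<in> \<int>}"

definition coset_of :: "'v::ab_group_add set \<Rightarrow> 'v \<Rightarrow> 'v set" where
  "coset_of L x = (+) x ` L"

definition disc_group :: "('v \<Rightarrow> 'v \<Rightarrow> real) \<Rightarrow> 'v::ab_group_add set \<Rightarrow> 'v set set" where
  "disc_group B L = coset_of L ` dual_lattice B L"

text \<open>The lattice \<open>L = U \<oplus> U \<oplus> (-1)L\<^sub>0\<close>, of signature \<open>(2, 2 + rank L\<^sub>0)\<close>.\<close>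

type_synonym 'a ambient = "(real \<times> real) \<times> (real \<times> real) \<times> 'a"

fun hyp_bil :: "real \<times> real \<Rightarrow> real \<times> real \<Rightarrow> real" where
  "hyp_bil (x1, x2) (y1, y2) = x1 * y2 + x2 * y1"

fun bil_L :: "'a::real_inner ambient \<Rightarrow> 'a ambient \<Rightarrow> real" where
  "bil_L (u, v, x) (u', v', x') = hyp_bil u u' + hyp_bil v v' - inner x x'"

definition lat_L :: "'a set \<Rightarrow> 'a ambient set" where
  "lat_L L0 = (\<int> \<times> \<int>) \<times> (\<int> \<times> \<int>) \<times> L0"

text \<open>The isomorphism \<open>L\<^sub>0\<^sup>#/L\<^sub>0 \<cong> L\<^sup>#/L\<close>, on representatives.\<close>

definition disc_class :: "'a::real_vector set \<Rightarrow> 'a \<Rightarrow> 'a ambient set" where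
  "disc_class L0 b = coset_of (lat_L L0) ((0, 0), (0, 0), b)"


section \<open>Vector valued modular forms for the Weil representation\<close>

text \<open>Elements of \<open>Mp\<^sub>2(\<int>)\<close> are pairs \<open>(M, \<phi>)\<close> with \<open>M = (a, b, c, d)\<close> of determinant one and \<open>\<phi>\<close> a
  holomorphic square root of \<open>c\<tau> + d\<close> on the upper half plane. Outside of the upper
  half plane \<open>\<phi>\<close> is normalised to be zero, so that equality of pairs is equality in \<open>Mp\<^sub>2(\<int>)\<close>.\<close>

type_synonym mp2 = "(int \<times> int \<times> int \<times> int) \<times> (complex \<Rightarrow> complex)"

fun moebius :: "int \<times> int \<times> int \<times> int \<Rightarrow> complex \<Rightarrow> complex" where
  "moebius (a, b, c, d) \<tau> = (of_int a * \<tau> + of_int b) / (of_int c * \<tau> + of_int d)"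

definition Mp2 :: "mp2 set" where
  "Mp2 = {((a, b, c, d), \<phi>). a * d - b * c = 1 \<and> \<phi> holomorphic_on upper_half_plane \<and>
     (\<forall>\<tau>\<in>upper_half_plane. (\<phi> \<tau>)\<^sup>2 = of_int c * \<tau> + of_int d) \<and>
     (\<forall>\<tau>. \<tau> \<notin> upper_half_plane \<longrightarrow> \<phi> \<tau> = 0)}"

fun mp2_mult :: "mp2 \<Rightarrow> mp2 \<Rightarrow> mp2" where
  "mp2_mult ((a, b, c, d), \<phi>) ((a', b', c', d'), \<psi>) =
     ((a * a' + b * c', a * b' + b * d', c * a' + d * c', c * b' + d * d'),
      \<lambda>\<tau>. \<phi> (moebius (a', b', c', d') \<tau>) * \<psi> \<tau>)"

definition mp2_T :: mp2 where
  "mp2_T = ((1, 1, 0, 1), \<lambda>\<tau>. if \<tau> \<in> upper_half_plane then 1 else 0)"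

definition mp2_S :: mp2 where
  "mp2_S = ((0, -1, 1, 0), \<lambda>\<tau>. if \<tau> \<in> upper_half_plane then csqrt \<tau> else 0)"

text \<open>\<open>\<rho> g \<gamma> \<delta>\<close> is the coefficient of \<open>\<e>\<^sub>\<gamma>\<close> in \<open>\<rho>(g) \<e>\<^sub>\<delta>\<close>. As \<open>Mp\<^sub>2(\<int>)\<close> is generated by
  \<open>S\<close> and \<open>T\<close>, the predicate determines the representation on \<open>Mp\<^sub>2(\<int>)\<close>. Conventions are those of
  Borcherds, with \<open>(bp, bm)\<close> the signature:
  \<open>\<rho>(T) \<e>\<^sub>\<gamma> = e(q(\<gamma>)) \<e>\<^sub>\<gamma>\<close> and
  \<open>\<rho>(S) \<e>\<^sub>\<gamma> = \<surd>i ^ (bm - bp) / \<surd>|L\<^sup>#/L| \<Sum>\<^sub>\<delta> e(-(\<gamma>,\<delta>)) \<e>\<^sub>\<delta>\<close>.\<close>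

definition weil_representation ::
  "nat \<Rightarrow> nat \<Rightarrow> ('v \<Rightarrow> 'v \<Rightarrow> real) \<Rightarrow> 'v::ab_group_add set \<Rightarrow>
   (mp2 \<Rightarrow> 'v set \<Rightarrow> 'v set \<Rightarrow> complex) \<Rightarrow> bool" where
  "weil_representation bp bm B L \<rho> \<longleftrightarrow>
     (\<forall>g\<in>Mp2. \<forall>h\<in>Mp2. \<forall>\<gamma>\<in>disc_group B L. \<forall>\<delta>\<in>disc_group B L.
        \<rho> (mp2_mult g h) \<gamma> \<delta> = (\<Sum>\<epsilon>\<in>disc_group B L. \<rho> g \<gamma> \<epsilon> * \<rho> h \<epsilon> \<delta>)) \<and>
     (\<forall>x\<in>dual_lattice B L. \<forall>y\<in>dual_lattice B L.
        \<rho> mp2_T (coset_of L x) (coset_of L y) =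
          (if coset_of L x = coset_of L y then ee (of_real (quad B x)) else 0) \<and>
        \<rho> mp2_S (coset_of L x) (coset_of L y) =
          ee ((of_nat bm - of_nat bp) / 8) / of_real (sqrt (real (card (disc_group B L))))
            * ee (- of_real (B x y)))"

text \<open>Exponents lie in \<open>q(\<gamma>) + \<int>\<close>, as forced by \<open>\<rho>(T)\<close>, and are bounded below.\<close>

definition has_fourier_coeffs ::
  "('v \<Rightarrow> 'v \<Rightarrow> real) \<Rightarrow> 'v::ab_group_add set \<Rightarrow> ('v set \<Rightarrow> complex \<Rightarrow> complex) \<Rightarrow>
   ('v set \<Rightarrow> real \<Rightarrow> complex) \<Rightarrow> bool" where
  "has_fourier_coeffs B L F f \<longleftrightarrow>
     (\<forall>x\<in>dual_lattice B L.
        (\<exists>m0. \<forall>m. f (coset_of L x) m \<noteq> 0 \<longrightarrow> m0 \<le> m \<and> m - quad B x \<in> \<int>) \<and>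
        (\<forall>\<tau>\<in>upper_half_plane.
           ((\<lambda>m. f (coset_of L x) m * ee (of_real m * \<tau>)) has_sum F (coset_of L x) \<tau>)
             {m. m - quad B x \<in> \<int>}))"

text \<open>The integer \<open>k2\<close> is twice the weight.\<close>

definition weakly_holomorphic_form ::
  "('v \<Rightarrow> 'v \<Rightarrow> real) \<Rightarrow> 'v::ab_group_add set \<Rightarrow> (mp2 \<Rightarrow> 'v set \<Rightarrow> 'v set \<Rightarrow> complex) \<Rightarrow>
   int \<Rightarrow> ('v set \<Rightarrow> complex \<Rightarrow> complex) \<Rightarrow> bool" where
  "weakly_holomorphic_form B L \<rho> k2 F \<longleftrightarrow>
     (\<forall>\<gamma>\<in>disc_group B L. F \<gamma> holomorphic_on upper_half_plane) \<and>
     (\<forall>M \<phi>. (M, \<phi>) \<in> Mp2 \<longrightarrow>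
        (\<forall>\<tau>\<in>upper_half_plane. \<forall>\<gamma>\<in>disc_group B L.
           F \<gamma> (moebius M \<tau>) =
             \<phi> \<tau> powi k2 * (\<Sum>\<delta>\<in>disc_group B L. \<rho> (M, \<phi>) \<gamma> \<delta> * F \<delta> \<tau>))) \<and>
     (\<exists>f. has_fourier_coeffs B L F f)"


section \<open>Indices, positivity and Weyl chambers\<close>

text \<open>Indices \<open>[a,b,c]\<close>; real entries are allowed because the Weyl vector is in general not an element
  of the monoid \<open>\<Q>\<close> below.\<close>

type_synonym 'a idx = "real \<times> 'a \<times> real"

definition Q_monoid :: "'a::euclidean_space set \<Rightarrow> 'a idx set" where
  "Q_monoid L0 = \<int> \<times> dual_lattice inner L0 \<times> \<int>"

fun disc :: "'a::real_inner idx \<Rightarrow> real" where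
  "disc (a, b, c) = a * c - quad inner b"

text \<open>\<open>ws\<close> is the list of the vectors \<open>w\<^sub>1, w\<^sub>2, \<dots>\<close>\<close>

definition rational_basis :: "'a::euclidean_space set \<Rightarrow> 'a list \<Rightarrow> bool" where
  "rational_basis L0 ws \<longleftrightarrow> distinct ws \<and> independent (set ws) \<and> span (set ws) = UNIV \<and>
     (\<forall>w\<in>set ws. \<exists>k::int. k \<noteq> 0 \<and> of_int k *\<^sub>R w \<in> L0)"

definition pos_vec :: "'a::real_inner list \<Rightarrow> 'a \<Rightarrow> bool" where
  "pos_vec ws b \<longleftrightarrow>
     (\<exists>j<length ws. inner b (ws ! j) > 0 \<and> (\<forall>j'<j. inner b (ws ! j') = 0))"

fun pos_idx :: "'a::real_inner list \<Rightarrow> 'a idx \<Rightarrow> bool" where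
  "pos_idx ws (a, b, c) \<longleftrightarrow> c > 0 \<or> (c = 0 \<and> a > 0) \<or> (a = 0 \<and> c = 0 \<and> pos_vec ws b)"

definition pos_Q :: "'a::euclidean_space set \<Rightarrow> 'a list \<Rightarrow> 'a idx set" where
  "pos_Q L0 ws = {x \<in> Q_monoid L0. pos_idx ws x}"

text \<open>\<open>f(b,m)\<close> for \<open>b \<in> L\<^sub>0\<^sup>#\<close>, and \<open>f(b, disc([a,b,c]))\<close>\<close>

definition coeff_at :: "'a::real_vector set \<Rightarrow> ('a ambient set \<Rightarrow> real \<Rightarrow> int) \<Rightarrow> 'a \<Rightarrow> real \<Rightarrow> int" where
  "coeff_at L0 f b m = f (disc_class L0 b) m"

fun mult_at :: "'a::real_inner set \<Rightarrow> ('a ambient set \<Rightarrow> real \<Rightarrow> int) \<Rightarrow> 'a idx \<Rightarrow> int" where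
  "mult_at L0 f (a, b, c) = coeff_at L0 f b (disc (a, b, c))"

fun real_pairing :: "'a::real_inner idx \<Rightarrow> real \<times> real \<times> 'a \<Rightarrow> real" where
  "real_pairing (a, b, c) (y1, y2, y) = a * y1 + c * y2 - inner b y"

fun quad_Y :: "real \<times> real \<times> 'a::real_inner \<Rightarrow> real" where
  "quad_Y (y1, y2, y) = y1 * y2 - quad inner y"

definition positive_cone :: "(real \<times> real \<times> 'a::real_inner) set" where
  "positive_cone = {Y. fst Y > 0 \<and> quad_Y Y > 0}"

definition walls ::
  "'a::euclidean_space set \<Rightarrow> ('a ambient set \<Rightarrow> real \<Rightarrow> int) \<Rightarrow> (real \<times> real \<times> 'a) set" where
  "walls L0 f =
     {Y. \<exists>x\<in>Q_monoid L0. disc x < 0 \<and> mult_at L0 f x \<noteq> 0 \<and> real_pairing x Y = 0}"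

text \<open>The positivity condition is imposed on those indices \<open>[a,b,c] \<succ> 0\<close> that contribute a
  nontrivial factor to the product. No \<open>Y\<close> pairs positively with all \<open>[a,b,c] \<succ> 0\<close>, as \<open>a\<close> is unbounded
  below when \<open>c > 0\<close>.\<close>

definition compatible_Weyl_chamber ::
  "'a::euclidean_space set \<Rightarrow> 'a list \<Rightarrow> ('a ambient set \<Rightarrow> real \<Rightarrow> int) \<Rightarrow>
   (real \<times> real \<times> 'a) set \<Rightarrow> bool" where
  "compatible_Weyl_chamber L0 ws f W \<longleftrightarrow>
     W \<in> components (positive_cone - walls L0 f) \<and>
     (\<forall>x\<in>pos_Q L0 ws. mult_at L0 f x \<noteq> 0 \<longrightarrow> (\<forall>Y\<in>W. real_pairing x Y > 0))"


section \<open>The formal exponential\<close>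

text \<open>A formal sum \<open>\<Sum> g([a,b,c]) e\<^bsup>[a,b,c]\<^esup>\<close> is represented by its coefficient function.\<close>

definition Phi_coeff ::
  "'a::euclidean_space set \<Rightarrow> 'a list \<Rightarrow> ('a ambient set \<Rightarrow> real \<Rightarrow> int) \<Rightarrow> 'a idx \<Rightarrow> complex" where
  "Phi_coeff L0 ws f x =
     - (\<Sum>(y, m) \<in> {(y, m :: nat). y \<in> pos_Q L0 ws \<and> m \<ge> 1 \<and> real m *\<^sub>R y = x}.
          of_int (mult_at L0 f y) / of_nat m)"

definition decompositions :: "'a::euclidean_space set \<Rightarrow> nat \<Rightarrow> 'a idx \<Rightarrow> 'a idx list set" where
  "decompositions L0 l x = {xs. length xs = l \<and> set xs \<subseteq> Q_monoid L0 \<and> sum_list xs = x}"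

text \<open>All sums written with \<^const>\<open>infsum\<close> or \<^const>\<open>suminf\<close> in this section have only finitely many
  nonzero terms.\<close>

definition Phi_power_coeff ::
  "'a::euclidean_space set \<Rightarrow> 'a list \<Rightarrow> ('a ambient set \<Rightarrow> real \<Rightarrow> int) \<Rightarrow> nat \<Rightarrow> 'a idx \<Rightarrow> complex"
  where
  "Phi_power_coeff L0 ws f l x =
     (\<Sum>\<^sub>\<infinity>xs\<in>decompositions L0 l x. prod_list (map (Phi_coeff L0 ws f) xs))"

definition weyl_a :: "'a::euclidean_space set \<Rightarrow> ('a ambient set \<Rightarrow> real \<Rightarrow> int) \<Rightarrow> real" where
  "weyl_a L0 f =
     1 / 24 * (\<Sum>\<^sub>\<infinity>b\<in>dual_lattice inner L0. real_of_int (coeff_at L0 f b (- quad inner b)))"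

definition weyl_b ::
  "'a::euclidean_space set \<Rightarrow> 'a list \<Rightarrow> ('a ambient set \<Rightarrow> real \<Rightarrow> int) \<Rightarrow> 'a" where
  "weyl_b L0 ws f =
     - (1 / 2) *\<^sub>R (\<Sum>\<^sub>\<infinity>b\<in>{b \<in> dual_lattice inner L0. pos_vec ws b}.
                    real_of_int (coeff_at L0 f b (- quad inner b)) *\<^sub>R b)"

definition weyl_c :: "'a::euclidean_space set \<Rightarrow> ('a ambient set \<Rightarrow> real \<Rightarrow> int) \<Rightarrow> real" where
  "weyl_c L0 f = weyl_a L0 f -
     (\<Sum>\<^sub>\<infinity>n\<in>{1::nat..}. real (\<Sum>d | d dvd n. d) *
        (\<Sum>\<^sub>\<infinity>b\<in>dual_lattice inner L0. real_of_int (coeff_at L0 f b (- real n - quad inner b))))"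

definition weyl_vector ::
  "'a::euclidean_space set \<Rightarrow> 'a list \<Rightarrow> ('a ambient set \<Rightarrow> real \<Rightarrow> int) \<Rightarrow> 'a idx" where
  "weyl_vector L0 ws f = (weyl_a L0 f, weyl_b L0 ws f, weyl_c L0 f)"

definition shifted_Q ::
  "'a::euclidean_space set \<Rightarrow> 'a list \<Rightarrow> ('a ambient set \<Rightarrow> real \<Rightarrow> int) \<Rightarrow> 'a idx set" where
  "shifted_Q L0 ws f = (+) (weyl_vector L0 ws f) ` Q_monoid L0"

definition Psi_coeff ::
  "'a::euclidean_space set \<Rightarrow> 'a list \<Rightarrow> ('a ambient set \<Rightarrow> real \<Rightarrow> int) \<Rightarrow> 'a idx \<Rightarrow> complex" where
  "Psi_coeff L0 ws f x =
     (if x \<in> shifted_Q L0 ws f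
      then \<Sum>l. 1 / fact l * Phi_power_coeff L0 ws f l (x - weyl_vector L0 ws f)
      else 0)"


section \<open>The Borcherds product\<close>

text \<open>Points \<open>(\<tau>, \<tau>', z)\<close>, where \<open>z \<in> L\<^sub>0 \<otimes> \<complex>\<close> is given by the pair of its real and imaginary part.\<close>

type_synonym 'a point = "complex \<times> complex \<times> 'a \<times> 'a"

fun Im_point :: "'a point \<Rightarrow> real \<times> real \<times> 'a" where
  "Im_point (\<tau>, \<tau>', x, y) = (Im \<tau>, Im \<tau>', y)"

fun char_at :: "'a::real_inner idx \<Rightarrow> 'a point \<Rightarrow> complex" where
  "char_at (a, b, c) (\<tau>, \<tau>', x, y) =
     ee (of_real a * \<tau> + of_real c * \<tau>' - Complex (inner b x) (inner b y))"

definition product_factor ::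
  "'a::real_inner set \<Rightarrow> ('a ambient set \<Rightarrow> real \<Rightarrow> int) \<Rightarrow> 'a point \<Rightarrow> 'a idx \<Rightarrow> complex" where
  "product_factor L0 f Z x = (1 - char_at x Z) powi mult_at L0 f x"

text \<open>Unordered infinite products, analogous to \<^const>\<open>infsum\<close>.\<close>

definition has_unordered_prod :: "('i \<Rightarrow> complex) \<Rightarrow> complex \<Rightarrow> 'i set \<Rightarrow> bool" where
  "has_unordered_prod h p A \<longleftrightarrow> (prod h \<longlongrightarrow> p) (finite_subsets_at_top A)"

definition unordered_prod :: "('i \<Rightarrow> complex) \<Rightarrow> 'i set \<Rightarrow> complex" where
  "unordered_prod h A = (THE p. has_unordered_prod h p A)"

definition Borcherds_product ::
  "'a::euclidean_space set \<Rightarrow> 'a list \<Rightarrow> ('a ambient set \<Rightarrow> real \<Rightarrow> int) \<Rightarrow> 'a point \<Rightarrow> complex" where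
  "Borcherds_product L0 ws f Z =
     char_at (weyl_vector L0 ws f) Z * unordered_prod (product_factor L0 f Z) (pos_Q L0 ws)"

text \<open>The points over the Weyl chamber at which the product converges absolutely, i.e. at which
  the sum of \<open>\<bar>u\<bar>\<close> over all factors \<open>(1 - u)\<^bsup>\<plusminus>1\<^esup>\<close>, counted with multiplicity, is finite.\<close>

definition convergence_domain ::
  "'a::euclidean_space set \<Rightarrow> 'a list \<Rightarrow> ('a ambient set \<Rightarrow> real \<Rightarrow> int) \<Rightarrow>
   (real \<times> real \<times> 'a) set \<Rightarrow> 'a point set" where
  "convergence_domain L0 ws f W =
     {Z. Im_point Z \<in> W \<and>
         (\<lambda>x. real_of_int \<bar>mult_at L0 f x\<bar> * norm (char_at x Z)) summable_on pos_Q L0 ws}"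

definition is_Fourier_expansion ::
  "'a::euclidean_space idx set \<Rightarrow> 'a point set \<Rightarrow> ('a point \<Rightarrow> complex) \<Rightarrow> ('a idx \<Rightarrow> complex) \<Rightarrow> bool"
  where
  "is_Fourier_expansion I D G g \<longleftrightarrow> (\<forall>x. x \<notin> I \<longrightarrow> g x = 0) \<and>
     (\<forall>Z\<in>D. ((\<lambda>x. g x * char_at x Z) has_sum G Z) I)"

end

theory Submission
  imports Defs
begin

text \<open>Let \<open>Y\<close> lie in the Weyl chamber. The coefficients of \<open>F\<close> vanish below some exponent \<open>D\<^sub>0\<close>, and
  \<open>disc x \<ge> D\<^sub>0\<close> bounds the index \<open>x\<close> in terms of its pairing with \<open>Y\<close>; so only finitely many indices
  of nontrivial factors pair with \<open>Y\<close> below a given bound, and these pairings are bounded away from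
  zero. As pairings add up in a decomposition, only finitely many lists of indices contribute to a
  coefficient of the formal exponential. For convergence, moving \<open>\<tau>\<close> towards the cusp by \<open>S\<close> and \<open>T\<close>
  gives \<open>F(\<tau>) = O(exp (B / Im \<tau>))\<close>, hence \<open>f(b, m) = O(exp (K \<surd>\<bar>m\<bar>))\<close>, which is dominated by
  \<open>e\<^bsup>-2\<pi>(x, Y)\<^esup>\<close> because \<open>(x, Y) \<ge> 2 \<surd>(disc x \<cdot> q(Y))\<close>. Where the product converges absolutely, it is the
  exponential of the absolutely convergent value of \<open>\<Phi>\<close>, and expanding \<open>exp\<close> as a sum over finite lists
  of indices and collecting lists with equal sum gives the coefficients. They are unique since an
  absolutely convergent exponential sum that vanishes identically has vanishing coefficients.\<close>

section \<open>Exponential sums\<close>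

lemma ee_add: "ee (x + y) = ee x * ee y"
  by (simp add: ee_def exp_add algebra_simps)

lemma ee_0 [simp]: "ee 0 = 1"
  by (simp add: ee_def)

lemma norm_ee: "norm (ee z) = exp (- 2 * pi * Im z)"
  by (simp add: ee_def)

lemma ee_half: "ee (1 / 2) = -1"
  by (simp add: ee_def)

lemma ee_of_Ints:
  assumes "x \<in> \<int>"
  shows "ee (of_real x) = 1"
proof -
  obtain k :: int where "x = of_int k"
    using assms by (auto elim: Ints_cases)
  then show ?thesis
    unfolding ee_def by (subst exp_eq_1) (auto intro!: exI[of _ k])
qed

text \<open>Replacing \<open>g u\<close> by \<open>(g u + e(-\<phi> x\<^sub>0 v) g (u + v)) / 2\<close> keeps the coefficient at \<open>x\<^sub>0\<close>, does not
  enlarge the others and annihilates every \<open>x\<close> with \<open>\<phi> x v - \<phi> x\<^sub>0 v = 1/2\<close>. Finitely many such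
  steps remove all but an arbitrarily small tail.\<close>

lemma norm_coeff_le_exponential_sum:
  fixes c :: "'i \<Rightarrow> complex" and \<phi> :: "'i \<Rightarrow> 'v::ab_group_add \<Rightarrow> real"
  assumes summable: "(\<lambda>x. norm (c x)) summable_on A" and x0: "x0 \<in> A"
    and add: "\<And>x u v. \<phi> x (u + v) = \<phi> x u + \<phi> x v"
    and g: "\<And>u. ((\<lambda>x. c x * ee (of_real (\<phi> x u))) has_sum g u) A"
    and M: "\<And>u. norm (g u) \<le> M"
    and separated: "\<And>x. x \<in> A \<Longrightarrow> x \<noteq> x0 \<Longrightarrow> \<exists>v. \<phi> x v - \<phi> x0 v = 1 / 2"
  shows "norm (c x0) \<le> M"
proof (rule field_le_epsilon)
  fix e :: real
  assume e: "e > 0"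
  have kill: "\<exists>c' h. c' x0 = c x0 \<and> (\<forall>x\<in>A. norm (c' x) \<le> norm (c x)) \<and> (\<forall>x\<in>S. c' x = 0) \<and>
      (\<forall>u. ((\<lambda>x. c' x * ee (of_real (\<phi> x u))) has_sum h u) A \<and> norm (h u) \<le> M)"
    if "finite S" "S \<subseteq> A - {x0}" for S
    using that
  proof (induction S rule: finite_induct)
    case empty
    show ?case
      by (rule exI[of _ c], rule exI[of _ g]) (use g M in auto)
  next
    case (insert s S)
    then obtain c' h where c': "c' x0 = c x0" "\<forall>x\<in>A. norm (c' x) \<le> norm (c x)" "\<forall>x\<in>S. c' x = 0"
      and h: "\<And>u. ((\<lambda>x. c' x * ee (of_real (\<phi> x u))) has_sum h u) A" "\<And>u. norm (h u) \<le> M"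
      by blast
    obtain v where v: "\<phi> s v - \<phi> x0 v = 1 / 2"
      using separated[of s] insert.prems by auto
    define \<omega> where "\<omega> x = ee (of_real (\<phi> x v - \<phi> x0 v))" for x
    define c'' where "c'' x = c' x * (1 + \<omega> x) / 2" for x
    define h' where "h' u = (h u + ee (of_real (- \<phi> x0 v)) * h (u + v)) / 2" for u
    have norm_\<omega>: "norm (\<omega> x) = 1" for x
      by (simp add: \<omega>_def norm_ee)
    have "norm (c'' x) \<le> norm (c' x)" for x
    proof -
      have "norm (1 + \<omega> x) \<le> 2"
        using norm_triangle_ineq[of 1 "\<omega> x"] norm_\<omega>[of x] by simp
      then have "norm (c' x) * norm (1 + \<omega> x) \<le> norm (c' x) * 2"
        by (rule mult_left_mono) simp
      then show ?thesis
        by (simp add: c''_def norm_mult norm_divide)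
    qed
    moreover have "c'' x0 = c x0"
      using c' by (simp add: c''_def \<omega>_def)
    moreover have "c'' x = 0" if "x \<in> insert s S" for x
    proof (cases "x = s")
      case True
      have "\<omega> s = -1"
        using ee_half by (simp add: \<omega>_def v)
      then show ?thesis
        using True by (simp add: c''_def)
    qed (use c' that in \<open>auto simp: c''_def\<close>)
    moreover have "((\<lambda>x. c'' x * ee (of_real (\<phi> x u))) has_sum h' u) A" for u
    proof -
      have "((\<lambda>x. (c' x * ee (of_real (\<phi> x u)) + ee (of_real (- \<phi> x0 v)) * (c' x * ee (of_real (\<phi> x (u + v))))) * (1 / 2))
          has_sum (h u + ee (of_real (- \<phi> x0 v)) * h (u + v)) * (1 / 2)) A"
        by (intro has_sum_cmult_left has_sum_add has_sum_cmult_right h)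
      moreover have "ee (of_real (\<phi> x (u + v))) = ee (of_real (\<phi> x u)) * ee (of_real (\<phi> x v))"
        and "\<omega> x = ee (of_real (\<phi> x v)) * ee (of_real (- \<phi> x0 v))" for x
        by (simp_all add: \<omega>_def add flip: ee_add)
      ultimately show ?thesis
        by (simp add: c''_def h'_def algebra_simps add_divide_distrib)
    qed
    moreover have "norm (h' u) \<le> M" for u
    proof -
      have "norm (h u + ee (of_real (- \<phi> x0 v)) * h (u + v)) \<le> norm (h u) + norm (h (u + v))"
        by (rule order_trans[OF norm_triangle_ineq]) (simp add: norm_mult norm_ee)
      then show ?thesis
        using h(2)[of u] h(2)[of "u + v"] by (simp add: h'_def norm_divide)
    qed
    ultimately show ?case
      using c'(2) by (intro exI[of _ c''] exI[of _ h']) (meson order_trans)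
  qed
  \<comment> \<open>Once the coefficients on a large finite set \<open>E'\<close> other than
    \<open>x0\<close> are annihilated, \<open>h 0\<close> differs from \<open>c x0\<close> only by a
    sum over \<open>A - E'\<close>, and the tail of the norms there is at most
    \<open>e\<close>.\<close>
  obtain T where T: "((\<lambda>x. norm (c x)) has_sum T) A"
    using summable by (auto simp: summable_on_def)
  obtain E where E: "finite E" "E \<subseteq> A" "dist (sum (\<lambda>x. norm (c x)) E) T \<le> e"
    using has_sum_finite_approximation[OF T e] by blast
  define E' where "E' = insert x0 E"
  have E': "finite E'" "E' \<subseteq> A"
    using E x0 by (auto simp: E'_def)
  obtain c' h where c': "c' x0 = c x0" "\<forall>x\<in>A. norm (c' x) \<le> norm (c x)" "\<forall>x\<in>E' - {x0}. c' x = 0"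
      and h: "\<And>u. ((\<lambda>x. c' x * ee (of_real (\<phi> x u))) has_sum h u) A" "\<And>u. norm (h u) \<le> M"
    using kill[of "E' - {x0}"] E' by blast
  have "\<phi> x 0 = 0" for x
    using add[of x 0 0] by simp
  then have h0: "(c' has_sum h 0) A"
    using h(1)[of 0] by simp
  have "(c' has_sum c x0) E'"
    using E' c' by (intro has_sum_finite_neutralI[of "{x0}"]) (auto simp: E'_def)
  then have rest: "(c' has_sum (h 0 - c x0)) (A - E')"
    using has_sum_Diff[OF h0 _ E'(2)] by blast
  have "((\<lambda>x. norm (c x)) has_sum (T - sum (\<lambda>x. norm (c x)) E')) (A - E')"
    using has_sum_Diff[OF T _ E'(2)] has_sum_finite[OF E'(1)] by blast
  then have "norm (h 0 - c x0) \<le> T - sum (\<lambda>x. norm (c x)) E'"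
    using norm_infsum_le[OF rest] c'(2) by blast
  also have "\<dots> \<le> T - sum (\<lambda>x. norm (c x)) E"
    using E' sum_mono2[of E' E "\<lambda>x. norm (c x)"] by (auto simp: E'_def)
  also have "\<dots> \<le> e"
    using E(3) by (simp add: dist_real_def)
  finally have "norm (c x0) - norm (h 0) \<le> e"
    using norm_triangle_ineq2[of "c x0" "h 0"] by (simp add: norm_minus_commute)
  then show "norm (c x0) \<le> M + e"
    using h(2)[of 0] by linarith
qed

section \<open>Exponentials as sums over lists\<close>

text \<open>Induction along the bijection \<open>(x, xs) \<mapsto> x # xs\<close>. The sum of the
  norms is carried along because absolute summability is what permits evaluating the sum over the
  product set one coordinate at a time.\<close>

lemma has_sum_prod_list_length:
  fixes a :: "'i \<Rightarrow> 'b::{real_normed_field,banach}"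
  assumes "(a has_sum s) A" "((\<lambda>x. norm (a x)) has_sum t) A"
  shows "((\<lambda>xs. prod_list (map a xs)) has_sum s ^ n) {xs \<in> lists A. length xs = n} \<and>
    ((\<lambda>xs. norm (prod_list (map a xs))) has_sum t ^ n) {xs \<in> lists A. length xs = n}"
proof (induction n)
  case 0
  have "{xs \<in> lists A. length xs = 0} = {[]}"
    by auto
  then show ?case
    by (simp add: has_sum_finite_iff)
next
  case (Suc n)
  let ?L = "\<lambda>n. {xs \<in> lists A. length xs = n}"
  have bij: "bij_betw (\<lambda>(x, xs). x # xs) (A \<times> ?L n) (?L (Suc n))"
    unfolding bij_betw_def
  proof
    show "(\<lambda>(x, xs). x # xs) ` (A \<times> ?L n) = ?L (Suc n)"
      by (force simp: length_Suc_conv image_iff)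
  qed (auto simp: inj_on_def)
  have norm_summable: "(\<lambda>(x, xs). norm (a x) * norm (prod_list (map a xs))) summable_on A \<times> ?L n"
    by (rule summable_on_SigmaI[where g = "\<lambda>x. norm (a x) * t ^ n"])
      (use Suc has_sum_imp_summable[OF assms(2)] in \<open>auto intro!: has_sum_cmult_right summable_on_cmult_left\<close>)
  then have "(\<lambda>p. norm ((\<lambda>(x, xs). a x * prod_list (map a xs)) p)) summable_on A \<times> ?L n"
    by (simp add: case_prod_unfold norm_mult)
  then have summable: "(\<lambda>(x, xs). a x * prod_list (map a xs)) summable_on A \<times> ?L n"
    by (rule abs_summable_summable)
  have "((\<lambda>(x, xs). norm (a x) * norm (prod_list (map a xs))) has_sum t * t ^ n) (A \<times> ?L n)"
    by (rule has_sum_SigmaI[OF _ has_sum_cmult_left[OF assms(2)] norm_summable])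
      (use Suc in \<open>auto intro!: has_sum_cmult_right\<close>)
  moreover have "((\<lambda>(x, xs). a x * prod_list (map a xs)) has_sum s * s ^ n) (A \<times> ?L n)"
    by (rule has_sum_SigmaI[OF _ has_sum_cmult_left[OF assms(1)] summable])
      (use Suc in \<open>auto intro!: has_sum_cmult_right\<close>)
  ultimately show ?case
    by (simp add: case_prod_unfold norm_mult flip: has_sum_reindex_bij_betw[OF bij])
qed

lemma has_sum_exp_real_series: "((\<lambda>n. t ^ n / fact n) has_sum exp t) UNIV" for t :: real
proof (rule norm_summable_imp_has_sum)
  show "(\<lambda>n. t ^ n / fact n) sums exp t"
    using exp_converges[of t] by (simp add: divide_inverse mult.commute)
  show "summable (\<lambda>n. norm (t ^ n / fact n))"
    using summable_norm_exp[of t] by (simp add: divide_inverse mult.commute abs_mult)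
qed

lemma has_sum_exp_complex_series: "((\<lambda>n. z ^ n / fact n) has_sum exp z) UNIV" for z :: complex
proof (rule norm_summable_imp_has_sum)
  show "(\<lambda>n. z ^ n / fact n) sums exp z"
    using exp_converges[of z] by (simp add: divide_inverse mult.commute scaleR_conv_of_real)
  show "summable (\<lambda>n. norm (z ^ n / fact n))"
    using summable_norm_exp[of z] by (simp add: divide_inverse mult.commute norm_mult norm_inverse)
qed

text \<open>Lists of length \<open>n\<close> contribute \<open>s ^ n / fact n\<close>, so grouping
  by length yields the exponential series. The norms, grouped alike, give the convergent series of
  \<open>t ^ n / fact n\<close>, which justifies the grouping.\<close>

lemma has_sum_lists_exp:
  fixes a :: "'i \<Rightarrow> complex"
  assumes "(a has_sum s) A"
  shows "((\<lambda>xs. prod_list (map a xs) / fact (length xs)) has_sum exp s) (lists A)"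
proof -
  let ?L = "\<lambda>n. {xs \<in> lists A. length xs = n}"
  obtain t where t: "((\<lambda>x. norm (a x)) has_sum t) A"
    using assms summable_on_iff_abs_summable_on_complex[of a A] by (auto simp: summable_on_def)
  have len: "((\<lambda>xs. prod_list (map a xs)) has_sum s ^ n) (?L n)"
    "((\<lambda>xs. norm (prod_list (map a xs))) has_sum t ^ n) (?L n)" for n
    using has_sum_prod_list_length[OF assms t, of n] by auto
  have bij: "bij_betw snd (Sigma UNIV ?L) (lists A)"
    by (rule bij_betwI[where g = "\<lambda>xs. (length xs, xs)"]) auto
  let ?f = "\<lambda>p. prod_list (map a (snd p)) / fact (length (snd p))"
  have "(\<lambda>p. norm (?f p)) summable_on Sigma UNIV ?L"
  proof (rule summable_on_SigmaI[where g = "\<lambda>n. t ^ n / fact n"])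
    show "((\<lambda>xs. norm (?f (n, xs))) has_sum t ^ n / fact n) (?L n)" for n
      using has_sum_divide_const[OF len(2)[of n], of "fact n"]
      by (rule iffD1[OF has_sum_cong, rotated]) (auto simp: norm_divide)
    show "(\<lambda>n. t ^ n / fact n) summable_on UNIV"
      using has_sum_exp_real_series by (auto simp: summable_on_def)
  qed auto
  then have "?f summable_on Sigma UNIV ?L"
    by (rule abs_summable_summable)
  then have "(?f has_sum exp s) (Sigma UNIV ?L)"
  proof (rule has_sum_SigmaI[OF _ has_sum_exp_complex_series, rotated])
    show "((\<lambda>xs. ?f (n, xs)) has_sum s ^ n / fact n) (?L n)" for n
      using has_sum_divide_const[OF len(1)[of n], of "fact n"]
      by (rule iffD1[OF has_sum_cong, rotated]) auto
  qed
  then show ?thesis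
    using has_sum_reindex_bij_betw[OF bij, of "\<lambda>xs. prod_list (map a xs) / fact (length xs)"] by simp
qed

section \<open>Unordered products and logarithms\<close>

lemma has_unordered_prod_exp:
  assumes "(l has_sum s) A" "\<And>x. x \<in> A \<Longrightarrow> h x = exp (l x)"
  shows "has_unordered_prod h (exp s) A"
  unfolding has_unordered_prod_def
proof (rule Lim_transform_eventually)
  show "((\<lambda>E. exp (sum l E)) \<longlongrightarrow> exp s) (finite_subsets_at_top A)"
    using assms(1) unfolding has_sum_def by (rule tendsto_exp)
  show "\<forall>\<^sub>F E in finite_subsets_at_top A. exp (sum l E) = prod h E"
    using assms(2) by (intro eventually_finite_subsets_at_top_weakI) (auto simp: exp_sum intro!: prod.cong)
qed

lemma unordered_prod_eqI:
  assumes "has_unordered_prod h p A"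
  shows "unordered_prod h A = p"
  unfolding unordered_prod_def
  using assms tendsto_unique[OF finite_subsets_at_top_neq_bot]
  by (intro the_equality) (auto simp: has_unordered_prod_def)

text \<open>The bound on the sum of the norms is linear in \<open>norm u\<close> as long as
  \<open>norm u\<close> stays away from 1; this is what makes the double family formed by the
  logarithm series of all factors absolutely summable.\<close>

lemma has_sum_neg_Ln_1_minus:
  assumes "norm u < 1"
  shows "((\<lambda>m. u ^ m / of_nat m) has_sum - Ln (1 - u)) {1..}"
    and "\<exists>t \<le> norm u / (1 - norm u). ((\<lambda>m. norm (u ^ m / of_nat m)) has_sum t) {1..}"
proof -
  have geo: "((\<lambda>m. norm u ^ m) has_sum (norm u / (1 - norm u))) {1..}"
    using has_sum_geometric_from_1[of "norm u"] assms by simp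
  have le: "norm (u ^ m / of_nat m) \<le> norm u ^ m" if "m \<in> {1..}" for m :: nat
  proof -
    have "norm u ^ m / real m \<le> norm u ^ m / 1"
      using that by (intro divide_left_mono) auto
    then show ?thesis
      by (simp add: norm_divide norm_power)
  qed
  have abs: "(\<lambda>m. norm (u ^ m / of_nat m)) summable_on {1..}"
    using has_sum_imp_summable[OF geo] le by (rule Infinite_Sum.abs_summable_on_comparison_test')
  then show "\<exists>t \<le> norm u / (1 - norm u). ((\<lambda>m. norm (u ^ m / of_nat m)) has_sum t) {1..}"
    using has_sum_mono[OF has_sum_infsum[OF abs] geo] le has_sum_infsum[OF abs] by blast
  \<comment> \<open>At \<open>m = 0\<close> the term is a division by zero and hence
    \<open>0\<close>, so summing over \<open>UNIV\<close> or over \<open>{1..}\<close> makes no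
    difference.\<close>
  have "((\<lambda>m. u ^ m / of_nat m) has_sum - Ln (1 - u)) UNIV"
  proof (rule norm_summable_imp_has_sum)
    show "(\<lambda>m. u ^ m / of_nat m) sums - Ln (1 - u)"
      using sums_minus[OF Ln_series'[of "- u"]] assms by simp
    have "(\<lambda>m. norm (u ^ m / of_nat m)) summable_on UNIV"
      using abs by (rule iffD1[OF summable_on_cong_neutral, rotated -1]) (auto simp: not_le)
    then show "summable (\<lambda>m. norm (u ^ m / of_nat m))"
      by (rule summable_on_imp_summable)
  qed
  then show "((\<lambda>m. u ^ m / of_nat m) has_sum - Ln (1 - u)) {1..}"
    by (rule iffD1[OF has_sum_cong_neutral, rotated -1]) (auto simp: not_le)
qed

section \<open>Points with integral coordinates\<close>

text \<open>The range is covered by two geometric progressions sharing 0; the point is that the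
  bound is independent of \<open>N\<close>.\<close>

lemma sum_exp_abs_int_le:
  fixes d :: real
  assumes "d > 0"
  shows "(\<Sum>j=-int N..int N. exp (- d * \<bar>of_int j\<bar>)) \<le> 2 / (1 - exp (- d))"
proof -
  have geo: "(\<Sum>i\<le>N. exp (- d) ^ i) \<le> 1 / (1 - exp (- d))"
  proof -
    have "(\<Sum>i\<le>N. exp (- d) ^ i) = (1 - exp (- d) ^ Suc N) / (1 - exp (- d))"
      using assms by (subst sum_gp0) auto
    also have "\<dots> \<le> 1 / (1 - exp (- d))"
      using assms by (intro divide_right_mono) auto
    finally show ?thesis .
  qed
  have exp_eq: "exp (- d) ^ i = exp (- d * real i)" for i
    by (simp add: exp_of_nat_mult[symmetric] mult.commute)
  have "(\<Sum>j=-int N..int N. exp (- d * \<bar>of_int j\<bar>)) \<le> (\<Sum>j\<in>int ` {..N} \<union> (\<lambda>i. - int i) ` {..N}. exp (- d * \<bar>of_int j\<bar>))"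
  proof (rule sum_mono2)
    show "{-int N..int N} \<subseteq> int ` {..N} \<union> (\<lambda>i. - int i) ` {..N}"
    proof
      fix j assume "j \<in> {-int N..int N}"
      then have "j = int (nat j) \<and> nat j \<le> N \<or> j = - int (nat (- j)) \<and> nat (- j) \<le> N"
        by auto
      then show "j \<in> int ` {..N} \<union> (\<lambda>i. - int i) ` {..N}"
        by blast
    qed
  qed auto
  also have "\<dots> \<le> (\<Sum>j\<in>int ` {..N}. exp (- d * \<bar>of_int j\<bar>)) + (\<Sum>j\<in>(\<lambda>i. - int i) ` {..N}. exp (- d * \<bar>of_int j\<bar>))"
    by (subst sum_Un) (auto intro!: sum_nonneg)
  also have "\<dots> = 2 * (\<Sum>i\<le>N. exp (- d) ^ i)"
    unfolding exp_eq by (subst (1 2) sum.reindex) (auto simp: inj_on_def)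
  finally show ?thesis
    using geo by simp
qed

text \<open>The integral coordinates \<open>k x v\<close> determine \<open>x\<close> since
  \<open>B\<close> spans, and up to a constant \<open>norm x\<close> dominates the sum of their
  absolute values. Every finite partial sum is therefore at most a product over \<open>B\<close> of
  one-dimensional sums.\<close>

lemma summable_on_exp_norm_integral:
  fixes B :: "'a::euclidean_space set"
  assumes "finite B" "span B = UNIV" "e > 0"
  shows "(\<lambda>x. exp (- e * norm x)) summable_on {x. \<forall>v\<in>B. inner x v \<in> \<int>}"
proof (rule nonneg_bdd_above_summable_on)
  define C where "C = (\<Sum>v\<in>B. norm v) + 1"
  have C: "C > 0"
    by (simp add: C_def add_nonneg_pos sum_nonneg)
  define d where "d = e / C"
  have d: "d > 0"
    using C assms by (simp add: d_def)
  \<comment> \<open>Restricting to \<open>B\<close> puts \<open>k x\<close> into a set of the form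
    \<open>PiE\<close>, over which a sum of products factors into a product of sums.\<close>
  define k where "k x = restrict (\<lambda>v. \<lfloor>inner x v\<rfloor>) B" for x
  let ?S = "{x. \<forall>v\<in>B. inner x v \<in> \<int>}"
  have k: "of_int (k x v) = inner x v" if "x \<in> ?S" "v \<in> B" for x v
    using that by (auto simp: k_def elim: Ints_cases)
  have inj: "inj_on k ?S"
  proof
    fix x y assume xy: "x \<in> ?S" "y \<in> ?S" "k x = k y"
    have "inner (x - y) v = 0" if "v \<in> B" for v
      using k[OF xy(1) that] k[OF xy(2) that] xy(3) by (simp add: inner_diff_left)
    then have "inner (x - y) v = 0" for v
      using span_induct[of v B "\<lambda>v. inner (x - y) v = 0"] assms(2)
      by (auto simp: subspace_def inner_add_right)
    then show "x = y"
      using inner_eq_zero_iff[of "x - y"] by simp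
  qed
  have exp_le: "exp (- e * norm x) \<le> (\<Prod>v\<in>B. exp (- d * \<bar>of_int (k x v)\<bar>))" if "x \<in> ?S" for x
  proof -
    have "(\<Sum>v\<in>B. \<bar>of_int (k x v)\<bar>) \<le> (\<Sum>v\<in>B. norm x * norm v)"
      using k[OF that] Cauchy_Schwarz_ineq2[of x] by (intro sum_mono) auto
    also have "\<dots> \<le> C * norm x"
      by (simp add: C_def algebra_simps sum_distrib_left)
    finally have "d * (\<Sum>v\<in>B. \<bar>of_int (k x v)\<bar>) \<le> d * (C * norm x)"
      using d by (intro mult_left_mono) auto
    then have "- e * norm x \<le> (\<Sum>v\<in>B. - d * \<bar>of_int (k x v)\<bar>)"
      using C by (simp add: d_def sum_distrib_left sum_negf)
    then show ?thesis
      using assms(1) by (simp add: exp_sum[symmetric])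
  qed
  show "bdd_above (sum (\<lambda>x. exp (- e * norm x)) ` {F. F \<subseteq> ?S \<and> finite F})"
  proof (rule bdd_aboveI2)
    fix F assume "F \<in> {F. F \<subseteq> ?S \<and> finite F}"
    then have F: "F \<subseteq> ?S" "finite F"
      by auto
    define N where "N = nat (Max (insert 0 ((\<lambda>(x, v). \<bar>k x v\<bar>) ` (F \<times> B))))"
    have N: "\<bar>k x v\<bar> \<le> int N" if "x \<in> F" "v \<in> B" for x v
    proof -
      have "\<bar>k x v\<bar> \<le> Max (insert 0 ((\<lambda>(x, v). \<bar>k x v\<bar>) ` (F \<times> B)))"
        using that F(2) assms(1) by (intro Max_ge) auto
      moreover have "0 \<le> Max (insert 0 ((\<lambda>(x, v). \<bar>k x v\<bar>) ` (F \<times> B)))"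
        using F(2) assms(1) by (intro Max_ge) auto
      ultimately show ?thesis
        by (simp add: N_def)
    qed
    have "sum (\<lambda>x. exp (- e * norm x)) F \<le> (\<Sum>x\<in>F. \<Prod>v\<in>B. exp (- d * \<bar>of_int (k x v)\<bar>))"
      using exp_le F by (intro sum_mono) blast
    also have "\<dots> = (\<Sum>p\<in>k ` F. \<Prod>v\<in>B. exp (- d * \<bar>of_int (p v)\<bar>))"
      using inj_on_subset[OF inj F(1)] by (simp add: sum.reindex)
    also have "\<dots> \<le> (\<Sum>p\<in>PiE B (\<lambda>_. {-int N..int N}). \<Prod>v\<in>B. exp (- d * \<bar>of_int (p v)\<bar>))"
      using N assms(1) by (intro sum_mono2 finite_PiE) (fastforce simp: k_def intro: prod_nonneg)+
    also have "\<dots> = (\<Prod>v\<in>B. \<Sum>j=-int N..int N. exp (- d * \<bar>of_int j\<bar>))"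
      using assms(1) by (intro prod_sum_PiE[symmetric]) auto
    also have "\<dots> \<le> (\<Prod>v\<in>B. 2 / (1 - exp (- d)))"
      using sum_exp_abs_int_le[OF d, of N] by (intro prod_mono) (auto intro: sum_nonneg)
    finally show "sum (\<lambda>x. exp (- e * norm x)) F \<le> (\<Prod>v\<in>B. 2 / (1 - exp (- d)))" .
  qed
qed auto

lemma finite_summable_on_ge:
  fixes g :: "'i \<Rightarrow> real"
  assumes "g summable_on A" "e > 0" "\<And>x. x \<in> A \<Longrightarrow> g x \<ge> 0"
  shows "finite {x \<in> A. g x \<ge> e}"
proof (rule ccontr)
  assume inf: "infinite {x \<in> A. g x \<ge> e}"
  obtain n :: nat where n: "infsum g A < real n * e"
    using ex_less_of_nat_mult[OF assms(2)] by blast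
  obtain E where E: "E \<subseteq> {x \<in> A. g x \<ge> e}" "finite E" "card E = n"
    using infinite_arbitrarily_large[OF inf] by blast
  have "real n * e \<le> sum g E"
    using sum_bounded_below[of E e g] E by (simp add: subset_iff)
  also have "\<dots> \<le> infsum g A"
    using E assms by (intro finite_sum_le_infsum) auto
  finally show False
    using n by simp
qed

text \<open>The condition \<open>norm x \<le> r\<close> says that the summable function
  \<open>exp (- norm x)\<close> is at least \<open>exp (- r)\<close>.\<close>

lemma finite_integral_bounded:
  fixes B :: "'a::euclidean_space set"
  assumes "finite B" "span B = UNIV"
  shows "finite {x. (\<forall>v\<in>B. inner x v \<in> \<int>) \<and> norm x \<le> r}"
proof -
  have "finite {x \<in> {x. \<forall>v\<in>B. inner x v \<in> \<int>}. exp (- 1 * norm x) \<ge> exp (- r)}"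
    using summable_on_exp_norm_integral[OF assms, of 1] by (intro finite_summable_on_ge) auto
  then show ?thesis
    by simp
qed

section \<open>The discriminant group\<close>

lemma is_lattice_basisE:
  assumes "is_lattice L"
  obtains B where "finite B" "span B = UNIV"
    "L = {v. \<exists>k :: 'a::euclidean_space \<Rightarrow> int. v = (\<Sum>b\<in>B. of_int (k b) *\<^sub>R b)}"
  using assms independent_imp_finite unfolding is_lattice_def by blast

lemma is_lattice_subset_basisE:
  fixes L :: "'a::euclidean_space set"
  assumes "is_lattice L"
  obtains B where "finite B" "span B = UNIV" "B \<subseteq> L"
proof -
  obtain B where B: "finite B" "span B = UNIV"
    "L = {v. \<exists>k :: 'a \<Rightarrow> int. v = (\<Sum>b\<in>B. of_int (k b) *\<^sub>R b)}"
    using is_lattice_basisE[OF assms] by blast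
  have "v = (\<Sum>b\<in>B. of_int (if b = v then 1 else 0) *\<^sub>R b)" if "v \<in> B" for v
  proof -
    have "(\<Sum>b\<in>B. of_int (if b = v then 1 else 0) *\<^sub>R b) = (\<Sum>b\<in>B. if b = v then b else 0)"
      by (rule sum.cong) auto
    then show ?thesis
      using that B(1) by simp
  qed
  then have "B \<subseteq> L"
    unfolding B(3) by (intro subsetI CollectI exI)
  then show thesis
    using that B by blast
qed

lemma is_lattice_add:
  assumes "is_lattice L" "x \<in> L" "y \<in> L"
  shows "x + y \<in> L"
proof -
  obtain B where B: "L = {v. \<exists>k :: 'a \<Rightarrow> int. v = (\<Sum>b\<in>B. of_int (k b) *\<^sub>R b)}"
    using is_lattice_basisE[OF assms(1)] by blast
  obtain k l :: "'a \<Rightarrow> int" where "x = (\<Sum>b\<in>B. of_int (k b) *\<^sub>R b)" "y = (\<Sum>b\<in>B. of_int (l b) *\<^sub>R b)"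
    using assms unfolding B by blast
  then have "x + y = (\<Sum>b\<in>B. of_int (k b + l b) *\<^sub>R b)"
    by (simp add: sum.distrib scaleR_add_left)
  then show ?thesis
    unfolding B by (intro CollectI exI[of _ "\<lambda>b. k b + l b"])
qed

lemma is_lattice_uminus:
  assumes "is_lattice L" "x \<in> L"
  shows "- x \<in> L"
proof -
  obtain B where B: "L = {v. \<exists>k :: 'a \<Rightarrow> int. v = (\<Sum>b\<in>B. of_int (k b) *\<^sub>R b)}"
    using is_lattice_basisE[OF assms(1)] by blast
  obtain k :: "'a \<Rightarrow> int" where "x = (\<Sum>b\<in>B. of_int (k b) *\<^sub>R b)"
    using assms unfolding B by blast
  then have "- x = (\<Sum>b\<in>B. of_int (- k b) *\<^sub>R b)"
    by (simp add: sum_negf)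
  then show ?thesis
    unfolding B by (intro CollectI exI[of _ "\<lambda>b. - k b"])
qed

lemma is_lattice_0: "is_lattice L \<Longrightarrow> 0 \<in> L"
  unfolding is_lattice_def by (auto intro!: exI[of _ "\<lambda>_. 0"])

text \<open>Polarisation of the integer valued quadratic form.\<close>

lemma even_lattice_integral:
  assumes "even_posdef_lattice L" "x \<in> L" "y \<in> L"
  shows "inner x y \<in> \<int>"
proof -
  have "x + y \<in> L"
    using assms is_lattice_add by (auto simp: even_posdef_lattice_def)
  then have "quad inner (x + y) - quad inner x - quad inner y \<in> \<int>"
    using assms by (intro Ints_diff) (auto simp: even_posdef_lattice_def)
  then show ?thesis
    by (simp add: quad_def inner_add_left inner_add_right inner_commute[of y x] add_divide_distrib)
qed

section \<open>The dual lattice and its classes\<close>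

lemma finite_dual_lattice_bounded:
  assumes "is_lattice L"
  shows "finite {b \<in> dual_lattice inner L. norm b \<le> r}"
proof -
  obtain B where B: "finite B" "span B = UNIV" "B \<subseteq> L"
    using is_lattice_subset_basisE[OF assms] by blast
  show ?thesis
    by (rule finite_subset[OF _ finite_integral_bounded[OF B(1,2), of r]])
      (use B(3) in \<open>auto simp: dual_lattice_def\<close>)
qed

lemma dual_lattice_add:
  "x \<in> dual_lattice inner L \<Longrightarrow> y \<in> dual_lattice inner L \<Longrightarrow> x + y \<in> dual_lattice inner L"
  by (simp add: dual_lattice_def inner_add_left)

lemma disc_class_add_lattice:
  assumes "is_lattice L0" "l \<in> L0"
  shows "disc_class L0 (b + l) = disc_class L0 b"
proof -
  have "(+) (b + l) ` L0 = (+) b ` L0"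
  proof (intro equalityI subsetI)
    fix x assume "x \<in> (+) (b + l) ` L0"
    then show "x \<in> (+) b ` L0"
      using is_lattice_add[OF assms] by (auto simp: add.assoc)
  next
    fix x assume "x \<in> (+) b ` L0"
    then obtain k where k: "k \<in> L0" "x = b + k"
      by auto
    then have "x = b + l + (k + - l)" "k + - l \<in> L0"
      using is_lattice_add[OF assms(1) k(1) is_lattice_uminus[OF assms]] by auto
    then show "x \<in> (+) (b + l) ` L0"
      by blast
  qed
  moreover have "disc_class L0 c = (\<int> \<times> \<int>) \<times> (\<int> \<times> \<int>) \<times> (+) c ` L0" for c
    by (force simp: disc_class_def coset_of_def lat_L_def)
  ultimately show ?thesis
    by simp
qed

text \<open>Subtracting the integral parts of the coordinates moves a dual vector, within its class,
  into the fundamental parallelepiped. It stays in the dual lattice because an even lattice is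
  integral, and only finitely many dual vectors are that short.\<close>

lemma finite_disc_classes:
  assumes "even_posdef_lattice L0"
  shows "finite (disc_class L0 ` dual_lattice inner L0)"
proof -
  have L: "is_lattice L0"
    using assms by (simp add: even_posdef_lattice_def)
  obtain B where B: "finite B" "span B = UNIV"
    "L0 = {v. \<exists>k :: 'a \<Rightarrow> int. v = (\<Sum>b\<in>B. of_int (k b) *\<^sub>R b)}"
    using is_lattice_basisE[OF L] by blast
  define r where "r = (\<Sum>v\<in>B. norm v)"
  have "disc_class L0 ` dual_lattice inner L0 \<subseteq> disc_class L0 ` {b \<in> dual_lattice inner L0. norm b \<le> r}"
  proof (rule image_subsetI)
    fix b assume b: "b \<in> dual_lattice inner L0"
    obtain u where u: "b = (\<Sum>v\<in>B. u v *\<^sub>R v)"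
      using span_finite[OF B(1)] B(2) by (metis (no_types, lifting) UNIV_I image_iff)
    define l where "l = (\<Sum>v\<in>B. of_int (- \<lfloor>u v\<rfloor>) *\<^sub>R v)"
    have l: "l \<in> L0"
      unfolding B(3) l_def by (intro CollectI exI[of _ "\<lambda>v. - \<lfloor>u v\<rfloor>"]) simp
    have "b + l = (\<Sum>v\<in>B. frac (u v) *\<^sub>R v)"
      unfolding u l_def frac_def by (simp add: sum.distrib[symmetric] scaleR_add_left[symmetric] del: scaleR_minus_left)
    moreover have "norm (\<Sum>v\<in>B. frac (u v) *\<^sub>R v) \<le> r"
      unfolding r_def
    proof (rule sum_norm_le)
      show "norm (frac (u v) *\<^sub>R v) \<le> norm v" for v
        using mult_right_mono[of "frac (u v)" 1 "norm v"] frac_lt_1[of "u v"] frac_ge_0[of "u v"]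
        by (auto simp: less_imp_le)
    qed
    moreover have "l \<in> dual_lattice inner L0"
      using even_lattice_integral[OF assms l] by (simp add: dual_lattice_def)
    then have "b + l \<in> dual_lattice inner L0"
      by (rule dual_lattice_add[OF b])
    ultimately show "disc_class L0 b \<in> disc_class L0 ` {b \<in> dual_lattice inner L0. norm b \<le> r}"
      using disc_class_add_lattice[OF L l, of b]
      by (intro image_eqI[of _ _ "b + l"]) auto
  qed
  then show ?thesis
    using finite_dual_lattice_bounded[OF L] by (meson finite_imageI finite_subset)
qed

lemma dual_lat_L_embed:
  assumes "b \<in> dual_lattice inner L0"
  shows "((0, 0), (0, 0), b) \<in> dual_lattice bil_L (lat_L L0)"
  using assms by (auto simp: dual_lattice_def lat_L_def)

text \<open>The hyperbolic planes are unimodular: pairing a dual vector with their standard basis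
  vectors forces its first four coordinates to be integers, and these can be absorbed into the
  coset.\<close>

lemma disc_group_lat_L:
  assumes "is_lattice L0"
  shows "disc_group bil_L (lat_L L0) = disc_class L0 ` dual_lattice inner L0"
proof (intro equalityI subsetI)
  fix \<gamma> assume "\<gamma> \<in> disc_group bil_L (lat_L L0)"
  then obtain x where "x \<in> dual_lattice bil_L (lat_L L0)" "\<gamma> = coset_of (lat_L L0) x"
    unfolding disc_group_def by blast
  moreover obtain x1 x2 x3 x4 b where "x = ((x1, x2), (x3, x4), b)"
    by (metis surj_pair)
  ultimately have x: "((x1, x2), (x3, x4), b) \<in> dual_lattice bil_L (lat_L L0)"
      and \<gamma>: "\<gamma> = coset_of (lat_L L0) ((x1, x2), (x3, x4), b)"
    by simp_all
  have pair: "bil_L ((x1, x2), (x3, x4), b) y \<in> \<int>" if "y \<in> lat_L L0" for y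
    using x that by (simp add: dual_lattice_def)
  note L0_0 = is_lattice_0[OF assms]
  have Ints: "x1 \<in> \<int>" "x2 \<in> \<int>" "x3 \<in> \<int>" "x4 \<in> \<int>"
    using pair[of "((0, 1), (0, 0), 0)"] pair[of "((1, 0), (0, 0), 0)"]
      pair[of "((0, 0), (0, 1), 0)"] pair[of "((0, 0), (1, 0), 0)"] L0_0
    by (simp_all add: lat_L_def)
  have b: "b \<in> dual_lattice inner L0"
    using pair[of "((0, 0), (0, 0), _)"] by (auto simp: dual_lattice_def lat_L_def)
  have Ints_shift: "(+) t ` \<int> = \<int>" if "t \<in> \<int>" for t :: real
  proof (intro equalityI subsetI)
    show "s \<in> (+) t ` \<int>" if "s \<in> \<int>" for s
      using \<open>t \<in> \<int>\<close> that by (intro image_eqI[of _ _ "s - t"]) auto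
  qed (use that in auto)
  have "coset_of (lat_L L0) ((y1, y2), (y3, y4), b) =
      ((+) y1 ` \<int> \<times> (+) y2 ` \<int>) \<times> ((+) y3 ` \<int> \<times> (+) y4 ` \<int>) \<times> (+) b ` L0" for y1 y2 y3 y4
    by (force simp: coset_of_def lat_L_def)
  then have "\<gamma> = disc_class L0 b"
    using Ints by (simp add: \<gamma> disc_class_def Ints_shift)
  then show "\<gamma> \<in> disc_class L0 ` dual_lattice inner L0"
    using b by blast
qed (auto simp: disc_group_def disc_class_def intro!: dual_lat_L_embed)

section \<open>Growth of weakly holomorphic forms and of their coefficients\<close>

lemma mp2_S_in_Mp2: "mp2_S \<in> Mp2"
proof -
  have "csqrt holomorphic_on upper_half_plane"
    by (intro holomorphic_intros) (auto simp: upper_half_plane_def complex_nonpos_Reals_iff)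
  then have "(\<lambda>\<tau>. if \<tau> \<in> upper_half_plane then csqrt \<tau> else 0) holomorphic_on upper_half_plane"
    by (rule holomorphic_transform) simp
  then show ?thesis
    by (simp add: mp2_S_def Mp2_def)
qed

text \<open>Moving \<open>\<tau>\<close> into the strip \<open>\<bar>Re \<tau>\<bar> \<le> 1/2\<close> and applying \<open>S\<close> at least doubles an imaginary part
  below \<open>1/2\<close>, so that the factors \<open>K\<close> picked up on the way are absorbed by \<open>exp (B / Im \<tau>)\<close>.\<close>

lemma growth_of_modular_bound:
  fixes G :: "complex \<Rightarrow> real"
  assumes T: "\<And>\<tau> k. Im \<tau> > 0 \<Longrightarrow> G (\<tau> + of_int k) = G \<tau>"
    and S: "\<And>\<tau>. Im \<tau> > 0 \<Longrightarrow> norm \<tau> \<le> 1 \<Longrightarrow> G \<tau> \<le> K * G (- 1 / \<tau>)"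
    and cusp: "\<And>\<tau>. Im \<tau> \<ge> 1 / 2 \<Longrightarrow> G \<tau> \<le> C * exp (B * Im \<tau>)"
    and nonneg: "C \<ge> 0" "B \<ge> 0" "K \<ge> 1"
    and \<tau>: "0 < Im \<tau>" "Im \<tau> < 1 / 2"
  shows "G \<tau> \<le> C * exp ((B + ln K) / Im \<tau>)"
proof -
  let ?B = "B + ln K"
  have lnK: "ln K \<ge> 0"
    using nonneg by simp
  \<comment> \<open>Here \<open>n\<close> bounds the number of doublings needed to leave the region
    \<open>Im \<tau> < 1 / 2\<close>; for \<open>n = 0\<close> the two assumptions contradict each
    other.\<close>
  have bound: "G \<tau> \<le> C * exp (?B / Im \<tau>)" if "(1 / 2) ^ n \<le> Im \<tau>" "Im \<tau> < 1 / 2" for n \<tau>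
    using that
  proof (induction n arbitrary: \<tau>)
    case (Suc n)
    define y where "y = Im \<tau>"
    have y: "0 < y" "y < 1 / 2"
      using Suc.prems less_le_trans[OF zero_less_power[of "1 / 2 :: real" "Suc n"]] by (simp_all only: y_def)
    define \<tau>0 where "\<tau>0 = \<tau> + of_int (- round (Re \<tau>))"
    have Im0: "Im \<tau>0 = y"
      by (simp add: \<tau>0_def y_def)
    have G0: "G \<tau> = G \<tau>0"
      using y unfolding \<tau>0_def y_def by (subst T) auto
    have "\<bar>Re \<tau>0\<bar> \<le> 1 / 2"
      using of_int_round_abs_le[of "Re \<tau>"] by (simp add: \<tau>0_def abs_minus_commute)
    then have "(Re \<tau>0)\<^sup>2 \<le> (1 / 2)\<^sup>2"
      by (simp add: abs_le_square_iff[symmetric])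
    moreover have "y\<^sup>2 < (1 / 2)\<^sup>2"
      using y by (intro power_strict_mono) auto
    ultimately have norm_sq: "(norm \<tau>0)\<^sup>2 < 1 / 2" "(norm \<tau>0)\<^sup>2 \<ge> y\<^sup>2"
      unfolding cmod_power2 Im0 by (simp_all add: power2_eq_square)
    then have norm_le: "norm \<tau>0 \<le> 1"
      using power2_le_imp_le[of "norm \<tau>0" 1] by simp
    define \<tau>' where "\<tau>' = - 1 / \<tau>0"
    have Im': "Im \<tau>' = y / (norm \<tau>0)\<^sup>2"
      by (simp add: \<tau>'_def Im_divide Im0 cmod_power2)
    have sq_pos: "(norm \<tau>0)\<^sup>2 > 0"
      using Im0 y by auto
    have Im'_ge: "2 * y \<le> Im \<tau>'"
    proof -
      have "y * (2 * (norm \<tau>0)\<^sup>2) \<le> y * 1"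
        using norm_sq y by (intro mult_left_mono) auto
      then show ?thesis
        using sq_pos by (simp add: Im' field_simps)
    qed
    have Im'_le: "Im \<tau>' \<le> 1 / y"
      using norm_sq y sq_pos by (simp add: Im' field_simps power2_eq_square)
    have "G \<tau> \<le> K * G \<tau>'"
      unfolding G0 \<tau>'_def using S[of \<tau>0] Im0 y norm_le by simp
    \<comment> \<open>The term \<open>y * ln K\<close> makes room for the factor \<open>K\<close>:
      multiplication by \<open>K\<close> turns this bound into \<open>C * exp (?B / y)\<close>.
      Below height 1/2 the doubling halves the exponent of the induction hypothesis; above it the
      cusp bound applies together with \<open>Im \<tau>' \<le> 1 / y\<close>.\<close>
    moreover have "G \<tau>' \<le> C * exp ((?B - y * ln K) / y)"
    proof (cases "Im \<tau>' < 1 / 2")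
      case True
      have "(1 / 2) ^ n \<le> Im \<tau>'"
        using Suc.prems Im'_ge by (simp add: y_def)
      then have "G \<tau>' \<le> C * exp (?B / Im \<tau>')"
        using Suc.IH True by blast
      also have "\<dots> \<le> C * exp ((?B - y * ln K) / y)"
      proof -
        have "?B / Im \<tau>' \<le> ?B / (2 * y)"
          using Im'_ge y nonneg lnK by (intro divide_left_mono) auto
        moreover have "y * ln K \<le> (1 / 2) * ?B"
          using y lnK nonneg by (intro mult_mono) auto
        then have "((1 / 2) * ?B) / y \<le> (?B - y * ln K) / y"
          using y by (intro divide_right_mono) (auto simp: algebra_simps add_divide_distrib)
        ultimately have "?B / Im \<tau>' \<le> (?B - y * ln K) / y"
          by simp
        then show ?thesis
          using nonneg(1) by (simp add: mult_left_mono)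
      qed
      finally show ?thesis .
    next
      case False
      then have "G \<tau>' \<le> C * exp (B * Im \<tau>')"
        using cusp by simp
      also have "\<dots> \<le> C * exp ((?B - y * ln K) / y)"
      proof -
        have "B * Im \<tau>' \<le> B / y"
          using mult_left_mono[OF Im'_le nonneg(2)] by simp
        moreover have "y * ln K \<le> 1 * ln K"
          using y lnK by (intro mult_right_mono) auto
        then have "B / y \<le> (?B - y * ln K) / y"
          using y by (intro divide_right_mono) auto
        ultimately show ?thesis
          using nonneg(1) by (simp add: mult_left_mono)
      qed
      finally show ?thesis .
    qed
    then have "K * G \<tau>' \<le> K * (C * exp ((?B - y * ln K) / y))"
      using nonneg by (intro mult_left_mono) auto
    also have "\<dots> = C * exp (?B / y)"
      using y nonneg by (simp add: diff_divide_distrib exp_diff)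
    finally show ?case
      using \<open>G \<tau> \<le> K * G \<tau>'\<close> by (simp add: y_def)
  qed simp
  obtain n where "(1 / 2) ^ n < Im \<tau>"
    using real_arch_pow_inv[of "Im \<tau>" "1 / 2"] \<tau> by auto
  then show ?thesis
    using bound[of n \<tau>] \<tau> by simp
qed

text \<open>On the representative \<open>((0, 0), (0, 0), b)\<close> the quadratic form of
  \<open>L\<close> is minus that of \<open>L0\<close>, whence the plus sign in
  \<open>m + quad inner b\<close>.\<close>

lemma has_fourier_coeffs_disc_class:
  assumes "has_fourier_coeffs bil_L (lat_L L0) F f" "b \<in> dual_lattice inner L0"
  shows "\<exists>m0. \<forall>m. f (disc_class L0 b) m \<noteq> 0 \<longrightarrow> m0 \<le> m"
    and "\<And>m. f (disc_class L0 b) m \<noteq> 0 \<Longrightarrow> m + quad inner b \<in> \<int>"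
    and "\<And>\<tau>. Im \<tau> > 0 \<Longrightarrow> ((\<lambda>m. f (disc_class L0 b) m * ee (of_real m * \<tau>)) has_sum F (disc_class L0 b) \<tau>)
      {m. m + quad inner b \<in> \<int>}"
proof -
  have q: "quad bil_L ((0, 0), (0, 0), b) = - quad inner b"
    by (simp add: quad_def)
  note bspec[OF assms(1)[unfolded has_fourier_coeffs_def] dual_lat_L_embed[OF assms(2)],
      unfolded q, folded disc_class_def]
  then show "\<exists>m0. \<forall>m. f (disc_class L0 b) m \<noteq> 0 \<longrightarrow> m0 \<le> m"
    "\<And>m. f (disc_class L0 b) m \<noteq> 0 \<Longrightarrow> m + quad inner b \<in> \<int>"
    "\<And>\<tau>. Im \<tau> > 0 \<Longrightarrow> ((\<lambda>m. f (disc_class L0 b) m * ee (of_real m * \<tau>)) has_sum F (disc_class L0 b) \<tau>)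
      {m. m + quad inner b \<in> \<int>}"
    by (auto simp: upper_half_plane_def)
qed

text \<open>Finiteness of the discriminant group makes the bound uniform in
  \<open>b\<close>.\<close>

lemma fourier_coeffs_lower_bound:
  assumes "even_posdef_lattice L0" "has_fourier_coeffs bil_L (lat_L L0) F f"
  shows "\<exists>m0. \<forall>b\<in>dual_lattice inner L0. \<forall>m. f (disc_class L0 b) m \<noteq> 0 \<longrightarrow> m0 \<le> m"
proof -
  let ?D = "disc_class L0 ` dual_lattice inner L0"
  have "\<forall>\<gamma>\<in>?D. \<exists>m0. \<forall>m. f \<gamma> m \<noteq> 0 \<longrightarrow> m0 \<le> m"
    using has_fourier_coeffs_disc_class(1)[OF assms(2)] by blast
  then obtain m0 where m0: "\<And>\<gamma> m. \<gamma> \<in> ?D \<Longrightarrow> f \<gamma> m \<noteq> 0 \<Longrightarrow> m0 \<gamma> \<le> m"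
    by metis
  have "Min (m0 ` ?D) \<le> m0 \<gamma>" if "\<gamma> \<in> ?D" for \<gamma>
    using that finite_disc_classes[OF assms(1)] by (intro Min_le) auto
  then show ?thesis
    using m0 by (meson image_eqI order_trans)
qed

text \<open>All exponents of one component are congruent modulo 1, so an integral translation
  multiplies it by a single number of modulus 1.\<close>

lemma norm_translation_invariant:
  assumes "has_fourier_coeffs bil_L (lat_L L0) F f" "b \<in> dual_lattice inner L0" "Im \<tau> > 0"
  shows "norm (F (disc_class L0 b) (\<tau> + of_int k)) = norm (F (disc_class L0 b) \<tau>)"
proof -
  let ?\<gamma> = "disc_class L0 b" and ?A = "{m. m + quad inner b \<in> \<int>}"
  let ?e = "ee (of_real (- quad inner b * of_int k))"
  have ee_shift: "ee (of_real m * (\<tau> + of_int k)) = ?e * ee (of_real m * \<tau>)" if "m \<in> ?A" for m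
  proof -
    have "ee (of_real ((m + quad inner b) * of_int k)) = 1"
      using that by (intro ee_of_Ints Ints_mult) auto
    moreover have "ee (of_real m * (\<tau> + of_int k)) =
        ee (of_real ((m + quad inner b) * of_int k)) * ?e * ee (of_real m * \<tau>)"
      by (simp add: algebra_simps flip: ee_add)
    ultimately show ?thesis
      by simp
  qed
  have "((\<lambda>m. ?e * (f ?\<gamma> m * ee (of_real m * \<tau>))) has_sum ?e * F ?\<gamma> \<tau>) ?A"
    by (intro has_sum_cmult_right has_fourier_coeffs_disc_class assms)
  then have "((\<lambda>m. f ?\<gamma> m * ee (of_real m * (\<tau> + of_int k))) has_sum ?e * F ?\<gamma> \<tau>) ?A"
    by (rule iffD1[OF has_sum_cong, rotated]) (simp add: ee_shift)
  moreover have "((\<lambda>m. f ?\<gamma> m * ee (of_real m * (\<tau> + of_int k))) has_sum F ?\<gamma> (\<tau> + of_int k)) ?A"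
    using assms by (intro has_fourier_coeffs_disc_class(3)[OF assms(1,2)]) simp
  ultimately have "F ?\<gamma> (\<tau> + of_int k) = ?e * F ?\<gamma> \<tau>"
    using has_sum_unique by blast
  then show ?thesis
    by (simp add: norm_mult norm_ee)
qed

text \<open>Compares the expansion at \<open>\<tau>\<close> termwise with the absolutely convergent
  one at \<open>\<i> / 2\<close>: since only exponents \<open>m \<ge> m0\<close> occur, each term
  grows by a factor of at most \<open>exp (2 * pi * \<bar>m0\<bar> * Im \<tau>)\<close>.\<close>

lemma norm_cusp_bound:
  assumes "has_fourier_coeffs bil_L (lat_L L0) F f" "b \<in> dual_lattice inner L0"
    and m0: "\<And>m. f (disc_class L0 b) m \<noteq> 0 \<Longrightarrow> m0 \<le> m"
  shows "\<exists>C\<ge>0. \<forall>\<tau>. Im \<tau> \<ge> 1 / 2 \<longrightarrow> norm (F (disc_class L0 b) \<tau>) \<le> C * exp (2 * pi * \<bar>m0\<bar> * Im \<tau>)"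
proof -
  let ?\<gamma> = "disc_class L0 b" and ?A = "{m. m + quad inner b \<in> \<int>}"
  have "((\<lambda>m. f ?\<gamma> m * ee (of_real m * (\<i> / 2))) has_sum F ?\<gamma> (\<i> / 2)) ?A"
    by (intro has_fourier_coeffs_disc_class(3)[OF assms(1,2)]) simp
  then have "(\<lambda>m. norm (f ?\<gamma> m * ee (of_real m * (\<i> / 2)))) summable_on ?A"
    using iffD1[OF summable_on_iff_abs_summable_on_complex, OF has_sum_imp_summable] by blast
  then obtain T where T: "((\<lambda>m. norm (f ?\<gamma> m * ee (of_real m * (\<i> / 2)))) has_sum T) ?A"
    by (auto simp: summable_on_def)
  have T_nonneg: "T \<ge> 0"
    using has_sum_nonneg[OF T] by simp
  show ?thesis
  proof (intro exI[of _ "T * exp (2 * pi * \<bar>m0\<bar>)"] conjI allI impI)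
    fix \<tau> assume \<tau>: "Im \<tau> \<ge> 1 / 2"
    define E where "E = exp (2 * pi * \<bar>m0\<bar> * Im \<tau>)"
    have "norm (F ?\<gamma> \<tau>) \<le> T * E"
    proof (rule norm_infsum_le)
      show "((\<lambda>m. f ?\<gamma> m * ee (of_real m * \<tau>)) has_sum F ?\<gamma> \<tau>) ?A"
        using \<tau> by (intro has_fourier_coeffs_disc_class(3)[OF assms(1,2)]) simp
      show "((\<lambda>m. norm (f ?\<gamma> m * ee (of_real m * (\<i> / 2))) * E) has_sum T * E) ?A"
        by (rule has_sum_cmult_left[OF T])
      show "norm (f ?\<gamma> m * ee (of_real m * \<tau>)) \<le> norm (f ?\<gamma> m * ee (of_real m * (\<i> / 2))) * E" for m
      proof (cases "f ?\<gamma> m = 0")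
        case False
        have "- m * (Im \<tau> - 1 / 2) \<le> \<bar>m0\<bar> * (Im \<tau> - 1 / 2)"
          using m0[OF False] \<tau> by (intro mult_right_mono) auto
        also have "\<dots> \<le> \<bar>m0\<bar> * Im \<tau>"
          by (simp add: mult_left_mono)
        finally have "2 * pi * (- m * (Im \<tau> - 1 / 2)) \<le> 2 * pi * (\<bar>m0\<bar> * Im \<tau>)"
          by (intro mult_left_mono) auto
        then have "exp (- 2 * pi * (m * Im \<tau>)) \<le> exp (- 2 * pi * (m * (1 / 2)) + 2 * pi * \<bar>m0\<bar> * Im \<tau>)"
          by (simp add: algebra_simps)
        then have "exp (- 2 * pi * (m * Im \<tau>)) \<le> exp (- 2 * pi * (m * (1 / 2))) * E"
          by (simp only: E_def exp_add)
        then have "norm (f ?\<gamma> m) * exp (- 2 * pi * (m * Im \<tau>)) \<le> norm (f ?\<gamma> m) * (exp (- 2 * pi * (m * (1 / 2))) * E)"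
          by (intro mult_left_mono) auto
        then show ?thesis
          by (simp add: norm_mult norm_ee)
      qed simp
    qed
    also have "\<dots> \<le> T * exp (2 * pi * \<bar>m0\<bar>) * E"
    proof -
      have "1 \<le> exp (2 * pi * \<bar>m0\<bar>)"
        by simp
      then have "T * 1 \<le> T * exp (2 * pi * \<bar>m0\<bar>)"
        using T_nonneg by (rule mult_left_mono)
      then show ?thesis
        by (intro mult_right_mono) (auto simp: E_def)
    qed
    finally show "norm (F ?\<gamma> \<tau>) \<le> T * exp (2 * pi * \<bar>m0\<bar>) * exp (2 * pi * \<bar>m0\<bar> * Im \<tau>)"
      by (simp add: E_def)
  qed (use T_nonneg in simp)
qed

text \<open>\<open>S\<close> is applied at \<open>- 1 / \<tau>\<close>, which it maps to
  \<open>\<tau>\<close>. That point has modulus at least 1, so a nonpositive weight makes the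
  automorphy factor at most 1 in modulus; so are the entries of \<rho>(S), being phases divided by
  the square root of the group order.\<close>

lemma norm_S_bound:
  assumes L0: "even_posdef_lattice L0"
    and \<rho>: "weil_representation bp bm bil_L (lat_L L0) \<rho>"
    and F: "weakly_holomorphic_form bil_L (lat_L L0) \<rho> k2 F" and k2: "k2 \<le> 0"
    and b: "b \<in> dual_lattice inner L0" and \<tau>: "Im \<tau> > 0" "norm \<tau> \<le> 1"
  shows "norm (F (disc_class L0 b) \<tau>) \<le> (\<Sum>\<delta>\<in>disc_class L0 ` dual_lattice inner L0. norm (F \<delta> (- 1 / \<tau>)))"
proof -
  let ?D = "disc_class L0 ` dual_lattice inner L0"
  have L: "is_lattice L0"
    using L0 by (simp add: even_posdef_lattice_def)
  define \<tau>' where "\<tau>' = - 1 / \<tau>"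
  have nz: "\<tau> \<noteq> 0"
    using \<tau> by auto
  have up: "\<tau>' \<in> upper_half_plane"
    using \<tau> nz by (simp add: \<tau>'_def upper_half_plane_def Im_divide cmod_power2[symmetric])
  have norm': "norm \<tau>' \<ge> 1"
    using \<tau> nz by (simp add: \<tau>'_def norm_divide)
  obtain \<phi> where \<phi>: "mp2_S = ((0, -1, 1, 0), \<phi>)" "\<phi> \<tau>' = csqrt \<tau>'"
    using up by (simp add: mp2_S_def)
  have "moebius (0, -1, 1, 0) \<tau>' = \<tau>"
    by (simp add: \<tau>'_def nz)
  moreover have "disc_class L0 b \<in> disc_group bil_L (lat_L L0)"
    using b by (simp add: disc_group_lat_L[OF L])
  ultimately have F_eq: "F (disc_class L0 b) \<tau> = csqrt \<tau>' powi k2 * (\<Sum>\<delta>\<in>?D. \<rho> mp2_S (disc_class L0 b) \<delta> * F \<delta> \<tau>')"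
    using F[unfolded weakly_holomorphic_form_def, THEN conjunct2, THEN conjunct1, rule_format,
        OF mp2_S_in_Mp2[unfolded \<phi>(1)] up, of "disc_class L0 b"]
    unfolding \<phi> disc_group_lat_L[OF L] by simp
  have fin: "finite ?D"
    by (rule finite_disc_classes[OF L0])
  have "1 \<le> sqrt (real (card ?D))"
    using fin b by (subst real_sqrt_ge_1_iff) (auto simp: Suc_le_eq card_gt_0_iff)
  then have \<rho>_le: "norm (\<rho> mp2_S (disc_class L0 b) (disc_class L0 c)) \<le> 1" if "c \<in> dual_lattice inner L0" for c
    using \<rho> dual_lat_L_embed[OF b] dual_lat_L_embed[OF that]
    unfolding weil_representation_def disc_group_lat_L[OF L] disc_class_def[symmetric]
    by (simp add: disc_class_def norm_mult norm_divide norm_ee divide_le_eq_1)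
  have "norm (csqrt \<tau>' powi k2) \<le> 1"
  proof -
    have "norm (csqrt \<tau>') \<ge> 1"
      using norm' by (simp add: norm_csqrt)
    then show ?thesis
      using k2 one_le_power[of "norm (csqrt \<tau>')" "nat (- k2)"]
      by (auto simp: power_int_def norm_inverse norm_power power_inverse inverse_le_1_iff)
  qed
  moreover have "norm (\<Sum>\<delta>\<in>?D. \<rho> mp2_S (disc_class L0 b) \<delta> * F \<delta> \<tau>') \<le> (\<Sum>\<delta>\<in>?D. norm (F \<delta> \<tau>'))"
  proof (rule sum_norm_le)
    fix \<delta> assume "\<delta> \<in> ?D"
    then have "norm (\<rho> mp2_S (disc_class L0 b) \<delta>) * norm (F \<delta> \<tau>') \<le> 1 * norm (F \<delta> \<tau>')"
      using \<rho>_le by (intro mult_right_mono) auto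
    then show "norm (\<rho> mp2_S (disc_class L0 b) \<delta> * F \<delta> \<tau>') \<le> norm (F \<delta> \<tau>')"
      by (simp add: norm_mult)
  qed
  ultimately have "norm (F (disc_class L0 b) \<tau>) \<le> 1 * (\<Sum>\<delta>\<in>?D. norm (F \<delta> \<tau>'))"
    unfolding F_eq norm_mult by (intro mult_mono) auto
  then show ?thesis
    by (simp add: \<tau>'_def)
qed

text \<open>\<open>S\<close> mixes the components, so the growth argument is run for the sum
  \<open>G\<close> of all their norms; passing through \<open>S\<close> then costs a factor equal to
  the number of classes.\<close>

lemma weakly_holomorphic_form_growth:
  assumes L0: "even_posdef_lattice L0"
    and \<rho>: "weil_representation bp bm bil_L (lat_L L0) \<rho>"
    and F: "weakly_holomorphic_form bil_L (lat_L L0) \<rho> k2 F" and k2: "k2 \<le> 0"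
    and f: "has_fourier_coeffs bil_L (lat_L L0) F f"
  shows "\<exists>C\<ge>0. \<exists>B\<ge>0. \<forall>b\<in>dual_lattice inner L0. \<forall>\<tau>. 0 < Im \<tau> \<and> Im \<tau> < 1 / 2 \<longrightarrow>
    norm (F (disc_class L0 b) \<tau>) \<le> C * exp (B / Im \<tau>)"
proof -
  let ?D = "disc_class L0 ` dual_lattice inner L0"
  define G where "G \<tau> = (\<Sum>\<delta>\<in>?D. norm (F \<delta> \<tau>))" for \<tau>
  have fin: "finite ?D"
    by (rule finite_disc_classes[OF L0])
  have "0 \<in> dual_lattice inner L0"
    by (simp add: dual_lattice_def)
  then have card: "real (card ?D) \<ge> 1"
    using fin by (auto simp: Suc_le_eq card_gt_0_iff)
  obtain m0 where m0: "\<And>b m. b \<in> dual_lattice inner L0 \<Longrightarrow> f (disc_class L0 b) m \<noteq> 0 \<Longrightarrow> m0 \<le> m"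
    using fourier_coeffs_lower_bound[OF L0 f] by blast
  define B where "B = 2 * pi * \<bar>m0\<bar>"
  have "\<forall>\<delta>\<in>?D. \<exists>C\<ge>0. \<forall>\<tau>. Im \<tau> \<ge> 1 / 2 \<longrightarrow> norm (F \<delta> \<tau>) \<le> C * exp (B * Im \<tau>)"
    using norm_cusp_bound[OF f] m0 by (auto simp: B_def)
  then obtain c where c: "\<And>\<delta>. \<delta> \<in> ?D \<Longrightarrow> c \<delta> \<ge> 0"
    "\<And>\<delta> \<tau>. \<delta> \<in> ?D \<Longrightarrow> Im \<tau> \<ge> 1 / 2 \<Longrightarrow> norm (F \<delta> \<tau>) \<le> c \<delta> * exp (B * Im \<tau>)"
    by metis
  define C where "C = sum c ?D"
  have C: "C \<ge> 0"
    using c(1) by (simp add: C_def sum_nonneg)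
  have G_le: "G \<tau> \<le> C * exp ((B + ln (real (card ?D))) / Im \<tau>)" if "0 < Im \<tau>" "Im \<tau> < 1 / 2" for \<tau>
  proof (rule growth_of_modular_bound[where K = "real (card ?D)"])
    show "G (\<tau> + of_int k) = G \<tau>" if "Im \<tau> > 0" for \<tau> k
      unfolding G_def using norm_translation_invariant[OF f _ that] by (intro sum.cong) auto
    show "G \<tau> \<le> real (card ?D) * G (- 1 / \<tau>)" if "Im \<tau> > 0" "norm \<tau> \<le> 1" for \<tau>
      unfolding G_def using norm_S_bound[OF L0 \<rho> F k2 _ that] by (intro sum_bounded_above) auto
    show "G \<tau> \<le> C * exp (B * Im \<tau>)" if "Im \<tau> \<ge> 1 / 2" for \<tau>
      unfolding G_def C_def sum_distrib_right using c(2) that by (intro sum_mono) auto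
  qed (use that C card in \<open>auto simp: B_def\<close>)
  have "norm (F (disc_class L0 b) \<tau>) \<le> G \<tau>" if "b \<in> dual_lattice inner L0" for b \<tau>
    unfolding G_def using that fin by (intro member_le_sum) auto
  then show ?thesis
    using G_le C card
    by (intro exI[of _ C] conjI exI[of _ "B + ln (real (card ?D))"]) (auto simp: B_def intro: order_trans)
qed

text \<open>Bounding the coefficient by the growth of the form on the line \<open>Im \<tau> = 1 / (3 + \<surd>\<bar>m\<bar>)\<close>.\<close>

lemma fourier_coeff_bound:
  assumes L0: "even_posdef_lattice L0"
    and \<rho>: "weil_representation bp bm bil_L (lat_L L0) \<rho>"
    and F: "weakly_holomorphic_form bil_L (lat_L L0) \<rho> k2 F" and k2: "k2 \<le> 0"
    and f: "has_fourier_coeffs bil_L (lat_L L0) F f"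
  shows "\<exists>C\<ge>0. \<exists>K\<ge>0. \<forall>b\<in>dual_lattice inner L0. \<forall>m. norm (f (disc_class L0 b) m) \<le> C * exp (K * sqrt \<bar>m\<bar>)"
proof -
  obtain C B where C: "C \<ge> 0" "B \<ge> 0"
    and growth: "\<And>b \<tau>. b \<in> dual_lattice inner L0 \<Longrightarrow> 0 < Im \<tau> \<Longrightarrow> Im \<tau> < 1 / 2 \<Longrightarrow>
      norm (F (disc_class L0 b) \<tau>) \<le> C * exp (B / Im \<tau>)"
    using weakly_holomorphic_form_growth[OF assms] by blast
  have "norm (f (disc_class L0 b) m) \<le> C * exp (3 * B) * exp ((2 * pi + B) * sqrt \<bar>m\<bar>)"
    if b: "b \<in> dual_lattice inner L0" for b m
  proof (cases "f (disc_class L0 b) m = 0")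
    case False
    let ?\<gamma> = "disc_class L0 b" and ?A = "{m. m + quad inner b \<in> \<int>}"
    \<comment> \<open>The root balances the exponents \<open>B / y\<close> and
      \<open>2 * pi * (m * y)\<close>, both of which become at most linear in
      \<open>sqrt \<bar>m\<bar>\<close>; the 3 keeps \<open>y\<close> below 1/2, where the growth
      bound holds.\<close>
    define y where "y = 1 / (3 + sqrt \<bar>m\<bar>)"
    have pos: "3 + sqrt \<bar>m\<bar> > 0"
      by (simp add: add_pos_nonneg)
    have y: "y > 0" "y < 1 / 2"
      using pos by (auto simp: y_def field_simps add_pos_nonneg)
    \<comment> \<open>The decay in the imaginary direction goes into the coefficients, so that pure
      phases in the real variable \<open>u\<close> remain.\<close>
    define c where "c l = f ?\<gamma> l * ee (of_real l * (\<i> * of_real y))" for l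
    have has_sum: "((\<lambda>l. c l * ee (of_real (l * u))) has_sum F ?\<gamma> (of_real u + \<i> * of_real y)) ?A" for u :: real
    proof -
      have "c l * ee (of_real (l * u)) = f ?\<gamma> l * ee (of_real l * (of_real u + \<i> * of_real y))" for l
        by (simp add: c_def algebra_simps ee_add)
      then show ?thesis
        using has_fourier_coeffs_disc_class(3)[OF f b, of "of_real u + \<i> * of_real y"] y by simp
    qed
    have "norm (c m) \<le> C * exp (B / y)"
    proof (rule norm_coeff_le_exponential_sum[where \<phi> = "\<lambda>l u. l * u" and A = ?A])
      show "(\<lambda>l. norm (c l)) summable_on ?A"
        using has_sum_imp_summable[OF has_sum[of 0]] summable_on_iff_abs_summable_on_complex by auto
      show "m \<in> ?A"
        using has_fourier_coeffs_disc_class(2)[OF f b False] by simp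
      show "norm (F ?\<gamma> (of_real u + \<i> * of_real y)) \<le> C * exp (B / y)" for u
        using growth[OF b, of "of_real u + \<i> * of_real y"] y by simp
      show "\<exists>v. l * v - m * v = 1 / 2" if "l \<noteq> m" for l
        using that by (intro exI[of _ "1 / (2 * (l - m))"]) (simp add: divide_simps)
    qed (use has_sum in \<open>auto simp: algebra_simps\<close>)
    moreover have "norm (c m) = norm (f ?\<gamma> m) * exp (- 2 * pi * (m * y))"
      by (simp add: c_def norm_mult norm_ee)
    ultimately have "norm (f ?\<gamma> m) * exp (- 2 * pi * (m * y)) * exp (2 * pi * (m * y)) \<le> C * exp (B / y) * exp (2 * pi * (m * y))"
      by (intro mult_right_mono) auto
    then have "norm (f ?\<gamma> m) \<le> C * exp (B / y + 2 * pi * (m * y))"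
      by (simp add: exp_minus exp_add field_simps)
    also have "\<dots> \<le> C * exp (3 * B + (2 * pi + B) * sqrt \<bar>m\<bar>)"
    proof -
      have "m \<le> sqrt \<bar>m\<bar> * sqrt \<bar>m\<bar>"
        by simp
      also have "\<dots> \<le> sqrt \<bar>m\<bar> * (3 + sqrt \<bar>m\<bar>)"
        by (intro mult_left_mono) auto
      finally have "m * y \<le> sqrt \<bar>m\<bar>"
        using pos by (simp add: y_def divide_le_eq)
      then have "2 * pi * (m * y) \<le> 2 * pi * sqrt \<bar>m\<bar>"
        by (intro mult_left_mono) auto
      then show ?thesis
        using C by (intro mult_left_mono) (auto simp: y_def algebra_simps)
    qed
    finally show ?thesis
      by (simp add: exp_add mult.assoc)
  qed (use C in simp)
  then show ?thesis
    using C by (intro exI[of _ "C * exp (3 * B)"] conjI exI[of _ "2 * pi + B"]) auto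
qed

section \<open>Indices and the positive cone\<close>

lemma real_pairing_add: "real_pairing (x + x') Y = real_pairing x Y + real_pairing x' Y"
  by (cases x; cases x'; cases Y) (simp add: algebra_simps inner_add_left)

lemma real_pairing_add_right: "real_pairing x (Y + Y') = real_pairing x Y + real_pairing x Y'"
  by (cases x; cases Y; cases Y') (simp add: algebra_simps inner_add_right)

lemma real_pairing_scaleR: "real_pairing (r *\<^sub>R x) Y = r * real_pairing x Y"
  by (cases x; cases Y) (simp add: algebra_simps)

lemma real_pairing_scaleR_right: "real_pairing x (r *\<^sub>R Y) = r * real_pairing x Y"
  by (cases x; cases Y) (simp add: algebra_simps)

lemma real_pairing_0 [simp]: "real_pairing 0 Y = 0"
  using real_pairing_scaleR[of 0 0 Y] by simp

lemma real_pairing_sum_list: "real_pairing (sum_list xs) Y = (\<Sum>x\<leftarrow>xs. real_pairing x Y)"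
  by (induction xs) (simp_all add: real_pairing_add)

lemma norm_char_at: "norm (char_at x Z) = exp (- 2 * pi * real_pairing x (Im_point Z))"
  by (cases x; cases Z) (simp add: norm_ee)

lemma char_at_add: "char_at (x + x') Z = char_at x Z * char_at x' Z"
  by (cases x; cases x'; cases Z)
    (simp add: algebra_simps inner_add_left Complex_eq flip: ee_add)

lemma char_at_0 [simp]: "char_at 0 Z = 1"
  by (cases Z) (simp add: zero_prod_def Complex_eq)

lemma char_at_scaleR: "char_at (real m *\<^sub>R x) Z = char_at x Z ^ m"
  by (induction m) (simp_all add: scaleR_add_left char_at_add algebra_simps)

section \<open>The monoid of indices\<close>

lemma Q_monoid_0: "0 \<in> Q_monoid L0"
  by (simp add: Q_monoid_def dual_lattice_def zero_prod_def)

lemma Q_monoid_add: "x \<in> Q_monoid L0 \<Longrightarrow> y \<in> Q_monoid L0 \<Longrightarrow> x + y \<in> Q_monoid L0"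
  by (auto simp: Q_monoid_def dual_lattice_add)

lemma Q_monoid_scaleR: "x \<in> Q_monoid L0 \<Longrightarrow> real m *\<^sub>R x \<in> Q_monoid L0"
  by (induction m) (auto simp: scaleR_add_left Q_monoid_0 Q_monoid_add)

lemma Q_monoid_sum_list: "set xs \<subseteq> Q_monoid L0 \<Longrightarrow> sum_list xs \<in> Q_monoid L0"
  by (induction xs) (auto simp: Q_monoid_0 Q_monoid_add)

text \<open>Makes the results on points with integral coordinates available for indices: the dual
  vector is tested against a spanning set inside \<open>L0\<close>, the outer entries against unit
  vectors.\<close>

lemma Q_monoid_integral_coords:
  fixes L0 :: "'a::euclidean_space set"
  assumes "is_lattice L0"
  obtains B where "finite B" "span B = UNIV" "Q_monoid L0 \<subseteq> {x. \<forall>v\<in>B. inner x v \<in> \<int>}"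
proof -
  obtain B0 where B0: "finite B0" "span B0 = UNIV" "B0 \<subseteq> L0"
    using is_lattice_subset_basisE[OF assms] by blast
  define emb :: "'a \<Rightarrow> 'a idx" where "emb v = (0, v, 0)" for v
  let ?B = "insert (1, 0, 0) (insert (0, 0, 1) (emb ` B0))"
  have lin: "linear emb"
    by (rule linearI) (auto simp: emb_def)
  have "x \<in> span ?B" for x
  proof -
    obtain a b c where x: "x = (a, b, c)"
      by (cases x)
    have "emb b \<in> span (emb ` B0)"
      by (simp add: linear_span_image[OF lin] B0)
    then have "emb b \<in> span ?B"
      using span_mono[of "emb ` B0" ?B] by blast
    then have "a *\<^sub>R (1, 0, 0) + c *\<^sub>R (0, 0, 1) + emb b \<in> span ?B"
      by (intro span_add span_scale) (auto intro: span_base)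
    then show ?thesis
      by (simp add: x emb_def)
  qed
  then have "span ?B = UNIV"
    by blast
  moreover have "Q_monoid L0 \<subseteq> {x. \<forall>v\<in>?B. inner x v \<in> \<int>}"
    using B0(3) by (auto simp: Q_monoid_def dual_lattice_def emb_def)
  ultimately show thesis
    using that[of ?B] B0(1) by simp
qed

lemma summable_on_exp_norm_Q_monoid:
  assumes "is_lattice L0" "e > 0"
  shows "(\<lambda>x. exp (- e * norm x)) summable_on Q_monoid L0"
proof -
  obtain B where B: "finite B" "span B = UNIV" "Q_monoid L0 \<subseteq> {x. \<forall>v\<in>B. inner x v \<in> \<int>}"
    using Q_monoid_integral_coords[OF assms(1)] by blast
  show ?thesis
    by (rule summable_on_subset[OF summable_on_exp_norm_integral[OF B(1,2) assms(2)] B(3)])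
qed

lemma finite_Q_monoid_bounded:
  assumes "is_lattice L0"
  shows "finite {x \<in> Q_monoid L0. norm x \<le> r}"
proof -
  obtain B where B: "finite B" "span B = UNIV" "Q_monoid L0 \<subseteq> {x. \<forall>v\<in>B. inner x v \<in> \<int>}"
    using Q_monoid_integral_coords[OF assms] by blast
  show ?thesis
    by (rule finite_subset[OF _ finite_integral_bounded[OF B(1,2), of r]]) (use B(3) in auto)
qed

section \<open>Estimates in the positive cone\<close>

lemma positive_cone_coords:
  assumes "(y1, y2, y) \<in> positive_cone"
  shows "y1 > 0" "y2 > 0" "(norm y)\<^sup>2 < 2 * (y1 * y2)"
proof -
  show y1: "y1 > 0" and ineq: "(norm y)\<^sup>2 < 2 * (y1 * y2)"
    using assms by (auto simp: positive_cone_def quad_def power2_norm_eq_inner)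
  have "0 < y1 * y2"
    using ineq zero_le_power2[of "norm y"] by linarith
  then show "y2 > 0"
    using y1 zero_less_mult_pos by blast
qed

text \<open>The orthogonal complement of a vector of the positive cone is negative definite, so a lower
  bound on \<open>disc\<close> bounds an index in terms of its pairing with that vector.\<close>

lemma norm_le_real_pairing:
  fixes Y :: "real \<times> real \<times> 'a::euclidean_space"
  assumes "Y \<in> positive_cone"
  shows "\<exists>C>0. \<forall>x. D0 \<le> disc x \<longrightarrow> norm x \<le> C * (\<bar>real_pairing x Y\<bar> + 1)"
proof -
  obtain y1 y2 y where Y: "Y = (y1, y2, y)"
    by (cases Y)
  note pos = positive_cone_coords[OF assms[unfolded Y]]
  define P where "P = y1 * y2"
  have P: "P > 0"
    using pos by (simp add: P_def)
  define r where "r = sqrt (2 * P)"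
  have r: "r > 0" "r\<^sup>2 = 2 * P"
    using P by (simp_all add: r_def)
  \<comment> \<open>That \<theta> is less than 1 expresses that \<open>Y\<close> lies inside the
    cone; it allows a term \<open>\<theta> * N\<close> to be absorbed when \<open>N\<close> is
    estimated.\<close>
  define \<theta> where "\<theta> = norm y / r"
  have "norm y < r"
    using pos(3) r power_less_imp_less_base[of "norm y" 2 r] by (simp add: P_def)
  then have \<theta>: "0 \<le> \<theta>" "\<theta> < 1"
    using r by (simp_all add: \<theta>_def)
  define k where "k = sqrt (4 * P * \<bar>D0\<bar>)"
  have k: "k \<ge> 0" "k\<^sup>2 = 4 * P * \<bar>D0\<bar>"
    using P by (simp_all add: k_def)
  \<comment> \<open>\<open>M\<close> comes from solving \<open>N \<le> t + \<theta> * N + k\<close>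
    for \<open>N\<close>, where \<open>k\<close> is the error due to \<open>D0\<close>.\<close>
  define M where "M = (1 + k) / (1 - \<theta>)"
  have M: "M \<ge> 1"
    using \<theta> k by (simp add: M_def field_simps)
  define C where "C = M / r + (2 * M + 1) / (2 * y1) + (2 * M + 1) / (2 * y2)"
  have C: "C > 0"
    unfolding C_def using M r pos by (intro add_pos_pos divide_pos_pos) auto
  moreover have "norm x \<le> C * (\<bar>real_pairing x Y\<bar> + 1)" if disc: "D0 \<le> disc x" for x
  proof -
    obtain a b c where x: "x = (a, b, c)"
      by (cases x)
    define t where "t = \<bar>real_pairing x Y\<bar>"
    \<comment> \<open>As \<open>4 * P * (a * c) = s\<^sup>2 - d\<^sup>2\<close>, the lower bound on
      \<open>disc x\<close> turns into the upper bound \<open>s\<^sup>2 + k\<^sup>2\<close> for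
      \<open>N\<^sup>2\<close>, where \<open>N\<close> measures the part of the index transverse to
      \<open>Y\<close>.\<close>
    define s where "s = a * y1 + c * y2"
    define d where "d = a * y1 - c * y2"
    define N where "N = sqrt ((r * norm b)\<^sup>2 + d\<^sup>2)"
    have t: "t \<ge> 0"
      by (simp add: t_def)
    have N: "N \<ge> 0" "r * norm b \<le> N" "\<bar>d\<bar> \<le> N"
      by (auto simp: N_def intro: real_le_rsqrt)
    have "\<bar>inner b y\<bar> \<le> norm b * norm y"
      by (rule Cauchy_Schwarz_ineq2)
    also have "\<dots> = \<theta> * (r * norm b)"
      using r by (simp add: \<theta>_def)
    also have "\<dots> \<le> \<theta> * N"
      using N \<theta> by (intro mult_left_mono) auto
    finally have s_le: "\<bar>s\<bar> \<le> t + \<theta> * N"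
      by (simp add: s_def t_def x Y)
    have ac: "D0 + (norm b)\<^sup>2 / 2 \<le> a * c"
      using disc by (simp add: x quad_def power2_norm_eq_inner)
    have "N\<^sup>2 = 2 * P * (norm b)\<^sup>2 + d\<^sup>2"
      using P by (simp add: N_def power_mult_distrib r)
    also have "d\<^sup>2 = s\<^sup>2 - 4 * P * (a * c)"
      by (simp add: d_def s_def P_def power2_eq_square algebra_simps)
    also have "2 * P * (norm b)\<^sup>2 + (s\<^sup>2 - 4 * P * (a * c)) = s\<^sup>2 + 4 * P * ((norm b)\<^sup>2 / 2 - a * c)"
      by (simp add: algebra_simps)
    also have "\<dots> \<le> s\<^sup>2 + 4 * P * \<bar>D0\<bar>"
      using ac P by (intro add_left_mono mult_left_mono) auto
    also have "s\<^sup>2 + 4 * P * \<bar>D0\<bar> \<le> (t + \<theta> * N)\<^sup>2 + k\<^sup>2"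
      using power_mono[OF s_le, of 2] k by simp
    also have "\<dots> \<le> (t + \<theta> * N + k)\<^sup>2"
      using t \<theta> N k by (simp add: power2_sum)
    finally have "N \<le> t + \<theta> * N + k"
      using t \<theta> N k by (elim power2_le_imp_le) simp
    moreover have "t + k \<le> (1 + k) * (t + 1)"
      using t k by (simp add: algebra_simps)
    ultimately have "N * (1 - \<theta>) \<le> (1 + k) * (t + 1)"
      by (simp add: algebra_simps)
    then have N_le: "N \<le> M * (t + 1)"
      using \<theta> by (simp add: M_def field_simps)
    have "\<theta> * N \<le> 1 * N"
      using \<theta> N by (intro mult_right_mono) auto
    then have s_d: "\<bar>s\<bar> + \<bar>d\<bar> \<le> (2 * M + 1) * (t + 1)"
      using s_le N N_le t by (simp add: algebra_simps)
    have "norm b \<le> M / r * (t + 1)"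
      using N N_le r by (simp add: field_simps)
    moreover have "\<bar>a\<bar> \<le> (2 * M + 1) / (2 * y1) * (t + 1)"
    proof -
      have "a = (s + d) / (2 * y1)"
        using pos by (simp add: s_def d_def)
      then have "\<bar>a\<bar> = \<bar>s + d\<bar> / (2 * y1)"
        using pos by simp
      also have "\<dots> \<le> (2 * M + 1) * (t + 1) / (2 * y1)"
        using s_d pos by (intro divide_right_mono) auto
      finally show ?thesis
        by simp
    qed
    moreover have "\<bar>c\<bar> \<le> (2 * M + 1) / (2 * y2) * (t + 1)"
    proof -
      have "c = (s - d) / (2 * y2)"
        using pos by (simp add: s_def d_def)
      then have "\<bar>c\<bar> = \<bar>s - d\<bar> / (2 * y2)"
        using pos by simp
      also have "\<dots> \<le> (2 * M + 1) * (t + 1) / (2 * y2)"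
        using s_d pos by (intro divide_right_mono) auto
      finally show ?thesis
        by simp
    qed
    moreover have "norm x \<le> \<bar>a\<bar> + (norm b + \<bar>c\<bar>)"
      unfolding x using norm_Pair_le[of a "(b, c)"] norm_Pair_le[of b c] by simp
    ultimately show ?thesis
      by (simp add: C_def t_def[symmetric] algebra_simps)
  qed
  ultimately show ?thesis
    by blast
qed

text \<open>The reversed Cauchy-Schwarz inequality for a Lorentzian form; positive
  \<open>disc\<close> together with \<open>c \<ge> 0\<close> puts the index into the same half of
  the light cone as \<open>Y\<close>.\<close>

lemma real_pairing_ge_sqrt_disc:
  fixes x :: "'a::real_inner idx"
  assumes Y: "(y1, y2, y) \<in> positive_cone" and disc: "disc (a, b, c) > 0" and c: "c \<ge> 0"
  shows "2 * (sqrt (disc (a, b, c)) * sqrt (quad_Y (y1, y2, y))) \<le> real_pairing (a, b, c) (y1, y2, y)"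
proof -
  note pos = positive_cone_coords[OF Y]
  define d where "d = sqrt (disc (a, b, c))"
  define q where "q = sqrt (quad_Y (y1, y2, y))"
  have d: "d \<ge> 0" "a * c = d\<^sup>2 + (norm b)\<^sup>2 / 2"
    using disc by (auto simp: d_def quad_def power2_norm_eq_inner)
  have q: "q \<ge> 0" "y1 * y2 = q\<^sup>2 + (norm y)\<^sup>2 / 2"
    using Y by (auto simp: q_def quad_def power2_norm_eq_inner positive_cone_def)
  have "0 < a * c"
    using disc inner_ge_zero[of b] unfolding quad_def disc.simps by linarith
  then have ac: "a > 0" "c > 0"
    using c by (auto simp: zero_less_mult_iff)
  have "(2 * (d * q) + norm b * norm y)\<^sup>2 \<le> (a * y1 + c * y2)\<^sup>2"
  proof -
    \<comment> \<open>The defect of the inequality as a sum of squares; the last bracket vanishes by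
      the formulas for \<open>a * c\<close> and \<open>y1 * y2\<close>.\<close>
    have "0 \<le> 2 * (d * norm y - q * norm b)\<^sup>2 + (a * y1 - c * y2)\<^sup>2"
      by simp
    also have "\<dots> = (a * y1 + c * y2)\<^sup>2 - (2 * (d * q) + norm b * norm y)\<^sup>2
        + (4 * ((d\<^sup>2 + (norm b)\<^sup>2 / 2) * (q\<^sup>2 + (norm y)\<^sup>2 / 2)) - 4 * ((a * c) * (y1 * y2)))"
      by (simp add: power2_eq_square algebra_simps)
    finally show ?thesis
      by (simp add: d(2) q(2))
  qed
  then have "2 * (d * q) + norm b * norm y \<le> a * y1 + c * y2"
    using ac pos by (elim power2_le_imp_le) simp
  moreover have "inner b y \<le> norm b * norm y"
    by (rule norm_cauchy_schwarz)
  ultimately show ?thesis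
    by (simp add: d_def q_def)
qed

section \<open>Finiteness over a point of the chamber\<close>

text \<open>Isolates what the modular form and the chamber provide at a single point: a lower bound
  for the exponents that occur and positivity of the pairings. The finiteness results rest on these
  properties alone.\<close>

locale chamber_point =
  fixes L0 :: "'a::euclidean_space set" and ws :: "'a list"
    and f :: "'a ambient set \<Rightarrow> real \<Rightarrow> int" and Y :: "real \<times> real \<times> 'a" and D0 :: real
  assumes lattice: "is_lattice L0"
    and cone: "Y \<in> positive_cone"
    and disc_ge: "\<And>x. x \<in> Q_monoid L0 \<Longrightarrow> mult_at L0 f x \<noteq> 0 \<Longrightarrow> D0 \<le> disc x"
    and pairing_pos: "\<And>x. x \<in> pos_Q L0 ws \<Longrightarrow> mult_at L0 f x \<noteq> 0 \<Longrightarrow> real_pairing x Y > 0"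
begin

abbreviation contributing :: "'a idx set" where
  "contributing \<equiv> {x \<in> pos_Q L0 ws. mult_at L0 f x \<noteq> 0}"

abbreviation multiples :: "'a idx \<Rightarrow> ('a idx \<times> nat) set" where
  "multiples x \<equiv> {(y, m). y \<in> pos_Q L0 ws \<and> m \<ge> 1 \<and> real m *\<^sub>R y = x}"

lemma finite_contributing_le: "finite {x \<in> contributing. real_pairing x Y \<le> t}"
proof -
  obtain C where C: "C > 0" "\<And>x. D0 \<le> disc x \<Longrightarrow> norm x \<le> C * (\<bar>real_pairing x Y\<bar> + 1)"
    using norm_le_real_pairing[OF cone] by blast
  have "{x \<in> contributing. real_pairing x Y \<le> t} \<subseteq> {x \<in> Q_monoid L0. norm x \<le> C * (\<bar>t\<bar> + 1)}"
  proof clarify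
    fix a b c
    assume x: "(a, b, c) \<in> pos_Q L0 ws" "mult_at L0 f (a, b, c) \<noteq> 0" "real_pairing (a, b, c) Y \<le> t"
    then have Q: "(a, b, c) \<in> Q_monoid L0"
      by (simp add: pos_Q_def)
    have "norm (a, b, c) \<le> C * (\<bar>real_pairing (a, b, c) Y\<bar> + 1)"
      by (intro C disc_ge Q x)
    also have "\<dots> \<le> C * (\<bar>t\<bar> + 1)"
      using pairing_pos[OF x(1,2)] x(3) C(1) by (intro mult_left_mono) auto
    finally show "(a, b, c) \<in> Q_monoid L0 \<and> norm (a, b, c) \<le> C * (\<bar>t\<bar> + 1)"
      using Q by simp
  qed
  then show ?thesis
    using finite_Q_monoid_bounded[OF lattice] finite_subset by blast
qed

text \<open>Only finitely many contributing indices have pairing at most 1; the gap is the minimum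
  of their pairings and 1.\<close>

lemma pairing_gap: "\<exists>\<epsilon>>0. \<forall>x\<in>contributing. \<epsilon> \<le> real_pairing x Y"
proof -
  let ?S = "insert 1 ((\<lambda>x. real_pairing x Y) ` {x \<in> contributing. real_pairing x Y \<le> 1})"
  have fin: "finite ?S"
    using finite_contributing_le by blast
  have "Min ?S > 0"
    using fin pairing_pos by (subst Min_gr_iff) auto
  moreover have "Min ?S \<le> real_pairing x Y" if "x \<in> contributing" for x
  proof (cases "real_pairing x Y \<le> 1")
    case True
    then show ?thesis
      using that fin by (intro Min_le) auto
  next
    case False
    have "Min ?S \<le> 1"
      using fin by (intro Min_le) auto
    then show ?thesis
      using False by simp
  qed
  ultimately show ?thesis
    by blast
qed

section \<open>The support of \<Phi> and of its powers\<close>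

lemma Phi_coeff_nonzeroE:
  assumes "Phi_coeff L0 ws f x \<noteq> 0"
  obtains y m where "y \<in> contributing" "m \<ge> 1" "x = real m *\<^sub>R y"
proof -
  have "(\<Sum>p\<in>multiples x. case p of (y, m) \<Rightarrow> complex_of_int (mult_at L0 f y) / of_nat m) \<noteq> 0"
    using assms unfolding Phi_coeff_def neg_equal_0_iff_equal .
  then obtain p where p: "p \<in> multiples x" "(case p of (y, m) \<Rightarrow> complex_of_int (mult_at L0 f y) / of_nat m) \<noteq> 0"
    by (rule sum.not_neutral_contains_not_neutral)
  then show thesis
    using that by (cases p) auto
qed

text \<open>A nonzero coefficient sits at a multiple \<open>real m *\<^sub>R y\<close> of a
  contributing \<open>y\<close>; the pairing bounds \<open>y\<close> directly and, through the gap,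
  also \<open>m\<close>.\<close>

lemma finite_Phi_coeff_le: "finite {x. Phi_coeff L0 ws f x \<noteq> 0 \<and> real_pairing x Y \<le> t}"
proof -
  obtain \<epsilon> where \<epsilon>: "\<epsilon> > 0" "\<And>x. x \<in> contributing \<Longrightarrow> \<epsilon> \<le> real_pairing x Y"
    using pairing_gap by blast
  have "{x. Phi_coeff L0 ws f x \<noteq> 0 \<and> real_pairing x Y \<le> t} \<subseteq>
      (\<lambda>(y, m). real m *\<^sub>R y) ` ({y \<in> contributing. real_pairing y Y \<le> t} \<times> {..nat \<lfloor>t / \<epsilon>\<rfloor>})"
  proof (rule subsetI)
    fix x assume "x \<in> {x. Phi_coeff L0 ws f x \<noteq> 0 \<and> real_pairing x Y \<le> t}"
    then have x: "Phi_coeff L0 ws f x \<noteq> 0" "real_pairing x Y \<le> t"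
      by auto
    obtain y m where ym: "y \<in> contributing" "m \<ge> 1" "x = real m *\<^sub>R y"
      using Phi_coeff_nonzeroE[OF x(1)] .
    have le: "real m * real_pairing y Y \<le> t"
      using x(2) by (simp add: ym(3) real_pairing_scaleR)
    have y: "\<epsilon> \<le> real_pairing y Y"
      by (rule \<epsilon>(2)[OF ym(1)])
    have "1 * real_pairing y Y \<le> real m * real_pairing y Y"
      using ym(2) y \<epsilon>(1) by (intro mult_right_mono) auto
    then have "real_pairing y Y \<le> t"
      using le by simp
    moreover have "real m * \<epsilon> \<le> t"
      using mult_left_mono[OF y, of "real m"] le by simp
    then have "real m \<le> t / \<epsilon>"
      using \<epsilon>(1) by (simp add: field_simps)
    then have "m \<le> nat \<lfloor>t / \<epsilon>\<rfloor>"
      by (simp add: le_nat_floor)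
    ultimately show "x \<in> (\<lambda>(y, m). real m *\<^sub>R y) ` ({y \<in> contributing. real_pairing y Y \<le> t} \<times> {..nat \<lfloor>t / \<epsilon>\<rfloor>})"
      using ym by (intro image_eqI[of _ _ "(y, m)"]) auto
  qed
  moreover have "finite (({y \<in> contributing. real_pairing y Y \<le> t} \<times> {..nat \<lfloor>t / \<epsilon>\<rfloor>}))"
    using finite_contributing_le by simp
  ultimately show ?thesis
    using finite_surj by blast
qed

text \<open>Every entry has pairing at least \<epsilon> and the pairings add up, so the entries and
  the length are both bounded. Treating all lengths at once gives finiteness of the inner sums and
  of the set of relevant powers.\<close>

lemma finite_nonzero_lists:
  "finite {xs. sum_list xs = x \<and> prod_list (map (Phi_coeff L0 ws f) xs) \<noteq> 0}"
proof -
  obtain \<epsilon> where \<epsilon>: "\<epsilon> > 0" "\<And>x. x \<in> contributing \<Longrightarrow> \<epsilon> \<le> real_pairing x Y"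
    using pairing_gap by blast
  have gap: "\<epsilon> \<le> real_pairing z Y" if nz: "Phi_coeff L0 ws f z \<noteq> 0" for z
  proof -
    obtain y m where ym: "y \<in> contributing" "m \<ge> 1" "z = real m *\<^sub>R y"
      using Phi_coeff_nonzeroE[OF nz] .
    have "1 * \<epsilon> \<le> real m * real_pairing y Y"
      using ym(2) \<epsilon>(1) \<epsilon>(2)[OF ym(1)] by (intro mult_mono) auto
    then show ?thesis
      by (simp add: ym(3) real_pairing_scaleR)
  qed
  let ?t = "real_pairing x Y"
  let ?S = "{z. Phi_coeff L0 ws f z \<noteq> 0 \<and> real_pairing z Y \<le> ?t}"
  have "{xs. sum_list xs = x \<and> prod_list (map (Phi_coeff L0 ws f) xs) \<noteq> 0} \<subseteq>
      {xs. set xs \<subseteq> ?S \<and> length xs \<le> nat \<lfloor>?t / \<epsilon>\<rfloor>}"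
  proof clarify
    fix xs
    assume xs: "prod_list (map (Phi_coeff L0 ws f) xs) \<noteq> 0" and x: "x = sum_list xs"
    have nz: "Phi_coeff L0 ws f z \<noteq> 0" if "z \<in> set xs" for z
      using xs that by (force simp: prod_list_zero_iff)
    have t: "?t = (\<Sum>z\<leftarrow>xs. real_pairing z Y)"
      by (simp add: x real_pairing_sum_list)
    have "real_pairing z Y \<le> ?t" if "z \<in> set xs" for z
      unfolding t using order_trans[OF less_imp_le[OF \<epsilon>(1)] gap[OF nz]] that
      by (intro member_le_sum_list) auto
    moreover have "(\<Sum>z\<leftarrow>xs. \<epsilon>) \<le> ?t"
      unfolding t using gap[OF nz] by (intro sum_list_mono) auto
    then have "real (length xs) \<le> ?t / \<epsilon>"
      using \<epsilon>(1) by (simp add: sum_list_triv field_simps)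
    then have "length xs \<le> nat \<lfloor>?t / \<epsilon>\<rfloor>"
      by (simp add: le_nat_floor)
    ultimately show "set xs \<subseteq> {z. Phi_coeff L0 ws f z \<noteq> 0 \<and> real_pairing z Y \<le> real_pairing (sum_list xs) Y}
        \<and> length xs \<le> nat \<lfloor>real_pairing (sum_list xs) Y / \<epsilon>\<rfloor>"
      using nz by (auto simp: x)
  qed
  then show ?thesis
    using finite_lists_length_le[OF finite_Phi_coeff_le] finite_subset by blast
qed

lemma finite_nonzero_decompositions:
  "finite {xs \<in> decompositions L0 l x. prod_list (map (Phi_coeff L0 ws f) xs) \<noteq> 0}"
  by (rule finite_subset[OF _ finite_nonzero_lists[of x]]) (auto simp: decompositions_def)

lemma Phi_power_coeff_eq:
  "Phi_power_coeff L0 ws f l x =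
    (\<Sum>xs\<in>{xs \<in> decompositions L0 l x. prod_list (map (Phi_coeff L0 ws f) xs) \<noteq> 0}.
      prod_list (map (Phi_coeff L0 ws f) xs))"
  unfolding Phi_power_coeff_def
  by (rule infsumI, rule has_sum_finite_neutralI[OF finite_nonzero_decompositions[of l x]]) auto

lemma Phi_power_coeff_nonzero_subset:
  "{l. Phi_power_coeff L0 ws f l x \<noteq> 0} \<subseteq>
    length ` {xs. sum_list xs = x \<and> prod_list (map (Phi_coeff L0 ws f) xs) \<noteq> 0}"
proof clarify
  fix l assume "Phi_power_coeff L0 ws f l x \<noteq> 0"
  then obtain xs where "xs \<in> {xs \<in> decompositions L0 l x. prod_list (map (Phi_coeff L0 ws f) xs) \<noteq> 0}"
    unfolding Phi_power_coeff_eq by (rule sum.not_neutral_contains_not_neutral)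
  then show "l \<in> length ` {xs. sum_list xs = x \<and> prod_list (map (Phi_coeff L0 ws f) xs) \<noteq> 0}"
    by (auto simp: decompositions_def)
qed

lemma finite_nonzero_Phi_power: "finite {l. Phi_power_coeff L0 ws f l x \<noteq> 0}"
  by (rule finite_surj[OF finite_nonzero_lists Phi_power_coeff_nonzero_subset])

text \<open>Ensures that the sum in \<open>Phi_coeff\<close> is a genuine one, as \<open>sum\<close>
  over an infinite set would be 0. Since \<open>m \<ge> 1\<close>, \<open>y\<close> is no longer
  than \<open>x\<close>; and \<open>y\<close> determines \<open>m\<close> because 0 is not
  positive.\<close>

lemma finite_multiples: "finite (multiples x)"
proof (rule finite_imageD)
  have nonzero: "(0, 0, 0) \<notin> pos_Q L0 ws"
    by (auto simp: pos_Q_def pos_vec_def)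
  show "inj_on fst (multiples x)"
    using nonzero by (auto intro!: inj_onI)
  have "fst ` multiples x \<subseteq> {y \<in> Q_monoid L0. norm y \<le> norm x}"
  proof clarsimp
    fix a b c and m :: nat
    assume "(a, b, c) \<in> pos_Q L0 ws" "Suc 0 \<le> m"
    moreover have "1 * norm (a, b, c) \<le> real m * norm (a, b, c)"
      using \<open>Suc 0 \<le> m\<close> by (intro mult_right_mono) auto
    moreover have "norm (real m *\<^sub>R (a, b, c)) = real m * norm (a, b, c)"
      by (simp only: norm_scaleR)
    ultimately show "(a, b, c) \<in> Q_monoid L0 \<and> norm (a, b, c) \<le> norm (real m * a, real m *\<^sub>R b, real m * c)"
      by (simp add: pos_Q_def)
  qed
  then show "finite (fst ` multiples x)"
    using finite_Q_monoid_bounded[OF lattice] finite_subset by blast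
qed

end

section \<open>The expansion of the product\<close>

context chamber_point
begin

text \<open>With \<open>t\<close> the pairing of \<open>x\<close> and \<open>Y\<close>, the reversed
  Cauchy-Schwarz inequality and the bound on \<open>K\<close> give a coefficient of size at most
  \<open>A * exp t\<close>; for \<open>disc x \<le> 0\<close> the bound \<open>D0\<close> does so.
  The character contributes \<open>exp (- 2 * pi * t)\<close>, and the surplus decay dominates
  \<open>exp (- (1 / M) * norm x)\<close> since \<open>norm x \<le> M * (t + 1)\<close>.\<close>

lemma summable_on_characters:
  assumes bound: "\<And>x. x \<in> Q_monoid L0 \<Longrightarrow> real_of_int \<bar>mult_at L0 f x\<bar> \<le> C * exp (K * sqrt \<bar>disc x\<bar>)"
    and nonneg: "C \<ge> 0" "K \<ge> 0" and K: "K \<le> sqrt (quad_Y Y)" and Z: "Im_point Z = Y"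
  shows "(\<lambda>x. real_of_int \<bar>mult_at L0 f x\<bar> * norm (char_at x Z)) summable_on pos_Q L0 ws"
proof -
  obtain M where M: "M > 0" "\<And>x. D0 \<le> disc x \<Longrightarrow> norm x \<le> M * (\<bar>real_pairing x Y\<bar> + 1)"
    using norm_le_real_pairing[OF cone] by blast
  define A where "A = C * exp (K * sqrt \<bar>D0\<bar>)"
  have A: "A \<ge> 0"
    using nonneg by (simp add: A_def)
  have "(\<lambda>x. A * exp 1 * exp (- (1 / M) * norm x)) summable_on Q_monoid L0"
    using M(1) by (intro summable_on_cmult_right summable_on_exp_norm_Q_monoid lattice) simp
  then have "(\<lambda>x. A * exp 1 * exp (- (1 / M) * norm x)) summable_on pos_Q L0 ws"
    by (rule summable_on_subset) (auto simp: pos_Q_def)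
  then show ?thesis
  proof (rule summable_on_comparison_test)
    fix x assume x: "x \<in> pos_Q L0 ws"
    then have Q: "x \<in> Q_monoid L0"
      by (simp add: pos_Q_def)
    show "real_of_int \<bar>mult_at L0 f x\<bar> * norm (char_at x Z) \<le> A * exp 1 * exp (- (1 / M) * norm x)"
    proof (cases "mult_at L0 f x = 0")
      case False
      define t where "t = real_pairing x Y"
      have t: "t > 0"
        using pairing_pos[OF x False] by (simp add: t_def)
      have D0: "D0 \<le> disc x"
        using disc_ge Q False by blast
      have "K * sqrt \<bar>disc x\<bar> \<le> K * sqrt \<bar>D0\<bar> + t"
      proof (cases "disc x > 0")
        case True
        obtain a b c y1 y2 y where xY: "x = (a, b, c)" "Y = (y1, y2, y)"
          by (metis surj_pair)
        have "c \<ge> 0"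
          using x by (auto simp: xY pos_Q_def)
        then have "2 * (sqrt (disc x) * sqrt (quad_Y Y)) \<le> t"
          using real_pairing_ge_sqrt_disc[of y1 y2 y a b c] cone True by (simp only: xY t_def)
        moreover have "K * sqrt (disc x) \<le> sqrt (quad_Y Y) * sqrt (disc x)"
          using K True by (intro mult_right_mono) auto
        moreover have "0 \<le> K * sqrt \<bar>D0\<bar>" "0 \<le> K * sqrt (disc x)"
          using nonneg True by simp_all
        moreover have "sqrt (disc x) * sqrt (quad_Y Y) = sqrt (quad_Y Y) * sqrt (disc x)"
          by simp
        moreover have "\<bar>disc x\<bar> = disc x"
          using True by simp
        ultimately show ?thesis
          by linarith
      next
        case False
        then have "K * sqrt \<bar>disc x\<bar> \<le> K * sqrt \<bar>D0\<bar>"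
          using D0 nonneg by (intro mult_left_mono) auto
        then show ?thesis
          using t by simp
      qed
      then have "C * exp (K * sqrt \<bar>disc x\<bar>) \<le> C * exp (K * sqrt \<bar>D0\<bar> + t)"
        using nonneg by (intro mult_left_mono) auto
      then have mult_le: "real_of_int \<bar>mult_at L0 f x\<bar> \<le> A * exp t"
        using bound[OF Q] by (simp add: A_def exp_add)
      have "norm x \<le> M * (t + 1)"
        using M(2)[OF D0] t by (simp add: t_def)
      then have norm_le: "(1 / M) * norm x \<le> t + 1"
        using M(1) by (simp add: field_simps)
      have "1 * t \<le> pi * t"
        using t pi_ge_two by (intro mult_right_mono) auto
      then have "t + - 2 * pi * t \<le> 1 + - (1 / M) * norm x"
        using norm_le by linarith
      then have exp_le: "exp t * exp (- 2 * pi * t) \<le> exp 1 * exp (- (1 / M) * norm x)"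
        by (simp only: exp_add[symmetric] exp_le_cancel_iff)
      have "real_of_int \<bar>mult_at L0 f x\<bar> * exp (- 2 * pi * t) \<le> A * exp t * exp (- 2 * pi * t)"
        using mult_le by (intro mult_right_mono) auto
      also have "\<dots> = A * (exp t * exp (- 2 * pi * t))"
        by (rule mult.assoc)
      also have "\<dots> \<le> A * (exp 1 * exp (- (1 / M) * norm x))"
        using exp_le A by (intro mult_left_mono)
      finally show ?thesis
        unfolding norm_char_at Z t_def by (simp only: mult.assoc)
    qed (use A in simp)
  qed auto
qed

text \<open>The family \<open>h\<close> over pairs \<open>(y, m)\<close> is absolutely summable with
  sum \<open>s\<close>. Summed over \<open>m\<close> first it yields the logarithms of the factors;
  collected by the value of \<open>real m *\<^sub>R y\<close> it yields \<Phi>.\<close>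

lemma product_eq_exp_Phi:
  assumes Z: "Im_point Z = Y"
    and summable: "(\<lambda>x. real_of_int \<bar>mult_at L0 f x\<bar> * norm (char_at x Z)) summable_on pos_Q L0 ws"
  obtains s where "has_unordered_prod (product_factor L0 f Z) (exp s) (pos_Q L0 ws)"
    and "((\<lambda>x. Phi_coeff L0 ws f x * char_at x Z) has_sum s) (Q_monoid L0)"
proof -
  define u where "u y = char_at y Z" for y
  define h where "h p = (case p of (y, m) \<Rightarrow> of_int (- mult_at L0 f y) * (u y ^ m / of_nat m))" for p :: "'a idx \<times> nat"
  define l where "l y = of_int (- mult_at L0 f y) * - Ln (1 - u y)" for y
  obtain \<epsilon> where \<epsilon>: "\<epsilon> > 0" "\<And>x. x \<in> contributing \<Longrightarrow> \<epsilon> \<le> real_pairing x Y"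
    using pairing_gap by blast
  \<comment> \<open>The gap bounds all contributing characters by one \<delta> below 1, so the
    logarithm series are controlled uniformly by the factor
    \<open>1 / (1 - \<delta>)\<close>.\<close>
  define \<delta> where "\<delta> = exp (- 2 * pi * \<epsilon>)"
  have \<delta>: "\<delta> < 1"
    using \<epsilon>(1) by (simp add: \<delta>_def)
  have u_le: "norm (u y) \<le> \<delta>" if "y \<in> contributing" for y
    unfolding u_def norm_char_at Z \<delta>_def using \<epsilon>(2)[OF that] by simp
  \<comment> \<open>Where the multiplicity vanishes, \<open>u y\<close> may be large, but all terms
    and the logarithm \<open>l y\<close> are 0.\<close>
  have inner: "((\<lambda>m. h (y, m)) has_sum l y) {1..}" if y: "y \<in> pos_Q L0 ws" for y
  proof (cases "mult_at L0 f y = 0")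
    case False
    then have "norm (u y) < 1"
      using u_le[of y] y \<delta> by simp
    then show ?thesis
      unfolding h_def l_def prod.case by (intro has_sum_cmult_right has_sum_neg_Ln_1_minus)
  qed (simp add: h_def l_def)
  have inner_norm: "\<exists>t \<le> real_of_int \<bar>mult_at L0 f y\<bar> * norm (char_at y Z) * (1 / (1 - \<delta>)).
      ((\<lambda>m. norm (h (y, m))) has_sum t) {1..}" if y: "y \<in> pos_Q L0 ws" for y
  proof (cases "mult_at L0 f y = 0")
    case False
    then have u: "norm (u y) \<le> \<delta>"
      using u_le[of y] y by simp
    then obtain t where t: "t \<le> norm (u y) / (1 - norm (u y))"
      "((\<lambda>m. norm (u y ^ m / of_nat m)) has_sum t) {1..}"
      using has_sum_neg_Ln_1_minus(2)[of "u y"] \<delta> by auto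
    have "norm (u y) / (1 - norm (u y)) \<le> norm (u y) / (1 - \<delta>)"
      using u \<delta> by (intro divide_left_mono) auto
    then have "real_of_int \<bar>mult_at L0 f y\<bar> * t \<le> real_of_int \<bar>mult_at L0 f y\<bar> * (norm (u y) / (1 - \<delta>))"
      using t(1) by (intro mult_left_mono) auto
    moreover have "((\<lambda>m. norm (h (y, m))) has_sum real_of_int \<bar>mult_at L0 f y\<bar> * t) {1..}"
      using has_sum_cmult_right[OF t(2)] unfolding h_def prod.case norm_mult by simp
    ultimately show ?thesis
      by (intro exI[of _ "real_of_int \<bar>mult_at L0 f y\<bar> * t"]) (simp add: u_def)
  qed (use \<delta> in \<open>auto simp: h_def intro!: exI[of _ 0]\<close>)
  then obtain t where t: "\<And>y. y \<in> pos_Q L0 ws \<Longrightarrow> t y \<le> real_of_int \<bar>mult_at L0 f y\<bar> * norm (char_at y Z) * (1 / (1 - \<delta>))"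
    "\<And>y. y \<in> pos_Q L0 ws \<Longrightarrow> ((\<lambda>m. norm (h (y, m))) has_sum t y) {1..}"
    by metis
  have "t summable_on pos_Q L0 ws"
    by (rule summable_on_comparison_test[OF summable_on_cmult_left[OF summable] t(1)])
      (use has_sum_nonneg[OF t(2)] in auto)
  then have "(\<lambda>p. norm (h p)) summable_on (pos_Q L0 ws \<times> {1..})"
    using t(2) by (intro summable_on_SigmaI[where g = t]) auto
  then have "h summable_on (pos_Q L0 ws \<times> {1..})"
    by (rule abs_summable_summable)
  then obtain s where s: "(h has_sum s) (pos_Q L0 ws \<times> {1..})"
    by (auto simp: summable_on_def)
  have "(l has_sum s) (pos_Q L0 ws)"
    by (rule has_sum_SigmaD[OF s inner])
  then have "has_unordered_prod (product_factor L0 f Z) (exp s) (pos_Q L0 ws)"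
  proof (rule has_unordered_prod_exp)
    fix y assume y: "y \<in> pos_Q L0 ws"
    show "product_factor L0 f Z y = exp (l y)"
    proof (cases "mult_at L0 f y = 0")
      case False
      then have "norm (u y) < 1"
        using u_le[of y] y \<delta> by simp
      then have "1 - u y \<noteq> 0"
        by auto
      then have "exp (of_int (mult_at L0 f y) * Ln (1 - u y)) = (1 - u y) powi mult_at L0 f y"
        by (simp add: exp_power_int[symmetric])
      then show ?thesis
        by (simp add: product_factor_def l_def u_def)
    qed (simp add: product_factor_def l_def)
  qed
  moreover have "((\<lambda>x. Phi_coeff L0 ws f x * char_at x Z) has_sum s) (Q_monoid L0)"
  proof -
    \<comment> \<open>Each pair \<open>(y, m)\<close> lies over exactly one index, namely its
      multiple.\<close>
    have "bij_betw snd (Sigma (Q_monoid L0) multiples) (pos_Q L0 ws \<times> {1..})"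
      by (rule bij_betwI[where g = "\<lambda>(y, m). (real m *\<^sub>R y, (y, m))"])
        (auto simp: pos_Q_def simp del: scaleR_Pair intro: Q_monoid_scaleR)
    then have "((\<lambda>p. h (snd p)) has_sum s) (Sigma (Q_monoid L0) multiples)"
      using s by (simp add: has_sum_reindex_bij_betw)
    then show ?thesis
    proof (rule has_sum_SigmaD)
      fix x
      have "Phi_coeff L0 ws f x * char_at x Z = (\<Sum>p\<in>multiples x. h p)"
        unfolding Phi_coeff_def sum_negf[symmetric] sum_distrib_right
        by (intro sum.cong) (auto simp: h_def u_def simp flip: char_at_scaleR simp del: scaleR_Pair)
      then show "((\<lambda>p. h (snd (x, p))) has_sum Phi_coeff L0 ws f x * char_at x Z) (multiples x)"
        using finite_multiples by (simp add: has_sum_finiteI)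
    qed
  qed
  ultimately show thesis
    using that by blast
qed

text \<open>Merges the series over \<open>l\<close> and the sums over decompositions of length
  \<open>l\<close> into one finite sum over lists, the form in which the expansion of
  \<open>exp\<close> delivers it.\<close>

lemma exp_coeff_eq:
  "(\<Sum>l. 1 / fact l * Phi_power_coeff L0 ws f l x) =
    (\<Sum>xs\<in>{xs \<in> lists (Q_monoid L0). sum_list xs = x \<and> prod_list (map (Phi_coeff L0 ws f) xs) \<noteq> 0}.
      prod_list (map (Phi_coeff L0 ws f) xs) / fact (length xs))"
proof -
  let ?N = "{xs \<in> lists (Q_monoid L0). sum_list xs = x \<and> prod_list (map (Phi_coeff L0 ws f) xs) \<noteq> 0}"
  have fin: "finite ?N"
    by (rule finite_subset[OF _ finite_nonzero_lists[of x]]) auto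
  have decomp: "{xs \<in> decompositions L0 l x. prod_list (map (Phi_coeff L0 ws f) xs) \<noteq> 0} = {xs \<in> ?N. length xs = l}" for l
    by (auto simp: decompositions_def)
  have summand: "1 / fact l * Phi_power_coeff L0 ws f l x =
      (\<Sum>xs\<in>{xs \<in> ?N. length xs = l}. prod_list (map (Phi_coeff L0 ws f) xs) / fact (length xs))" for l
    unfolding Phi_power_coeff_eq decomp sum_distrib_left by (intro sum.cong) auto
  have "1 / fact l * Phi_power_coeff L0 ws f l x = 0" if "l \<notin> length ` ?N" for l
    unfolding summand by (rule sum.neutral) (use that in auto)
  then have "(\<Sum>l. 1 / fact l * Phi_power_coeff L0 ws f l x) = (\<Sum>l\<in>length ` ?N. 1 / fact l * Phi_power_coeff L0 ws f l x)"
    by (rule suminf_finite[OF finite_imageI[OF fin]])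
  also have "\<dots> = (\<Sum>xs\<in>?N. prod_list (map (Phi_coeff L0 ws f) xs) / fact (length xs))"
    unfolding summand by (rule sum.image_gen[OF fin, symmetric])
  finally show ?thesis .
qed

text \<open>Characters are multiplicative, so lists with equal sum share the same character and can
  be collected.\<close>

lemma has_sum_exp_coeff:
  assumes "((\<lambda>x. Phi_coeff L0 ws f x * char_at x Z) has_sum s) (Q_monoid L0)"
  shows "((\<lambda>x. (\<Sum>l. 1 / fact l * Phi_power_coeff L0 ws f l x) * char_at x Z) has_sum exp s) (Q_monoid L0)"
proof -
  let ?G = "\<lambda>xs. prod_list (map (\<lambda>x. Phi_coeff L0 ws f x * char_at x Z) xs) / fact (length xs)"
  let ?B = "\<lambda>x. {xs \<in> lists (Q_monoid L0). sum_list xs = x}"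
  have G_eq: "?G xs = prod_list (map (Phi_coeff L0 ws f) xs) / fact (length xs) * char_at (sum_list xs) Z" for xs
  proof -
    have "prod_list (map (\<lambda>x. Phi_coeff L0 ws f x * char_at x Z) xs) =
        prod_list (map (Phi_coeff L0 ws f) xs) * char_at (sum_list xs) Z"
      by (induction xs) (simp_all add: char_at_add)
    then show ?thesis
      by simp
  qed
  have "bij_betw snd (Sigma (Q_monoid L0) ?B) (lists (Q_monoid L0))"
    by (rule bij_betwI[where g = "\<lambda>xs. (sum_list xs, xs)"]) (auto intro!: Q_monoid_sum_list)
  then have "((\<lambda>p. ?G (snd p)) has_sum exp s) (Sigma (Q_monoid L0) ?B)"
    using has_sum_lists_exp[OF assms] by (simp add: has_sum_reindex_bij_betw[where f = ?G])
  then show ?thesis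
  proof (rule has_sum_SigmaD)
    fix x
    let ?N = "{xs \<in> lists (Q_monoid L0). sum_list xs = x \<and> prod_list (map (Phi_coeff L0 ws f) xs) \<noteq> 0}"
    have "finite ?N"
      by (rule finite_subset[OF _ finite_nonzero_lists[of x]]) auto
    then have "(?G has_sum ((\<Sum>l. 1 / fact l * Phi_power_coeff L0 ws f l x) * char_at x Z)) (?B x)"
      unfolding G_eq exp_coeff_eq sum_distrib_right by (rule has_sum_finite_neutralI) auto
    then show "((\<lambda>xs. ?G (snd (x, xs))) has_sum ((\<Sum>l. 1 / fact l * Phi_power_coeff L0 ws f l x) * char_at x Z)) (?B x)"
      by simp
  qed
qed

lemma has_unordered_prod_and_expansion:
  assumes Z: "Im_point Z = Y"
    and summable: "(\<lambda>x. real_of_int \<bar>mult_at L0 f x\<bar> * norm (char_at x Z)) summable_on pos_Q L0 ws"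
  shows "\<exists>p. has_unordered_prod (product_factor L0 f Z) p (pos_Q L0 ws)"
    and "((\<lambda>x. Psi_coeff L0 ws f x * char_at x Z) has_sum Borcherds_product L0 ws f Z) (shifted_Q L0 ws f)"
proof -
  obtain s where s: "has_unordered_prod (product_factor L0 f Z) (exp s) (pos_Q L0 ws)"
    "((\<lambda>x. Phi_coeff L0 ws f x * char_at x Z) has_sum s) (Q_monoid L0)"
    using product_eq_exp_Phi[OF assms] by blast
  show "\<exists>p. has_unordered_prod (product_factor L0 f Z) p (pos_Q L0 ws)"
    using s(1) by blast
  let ?w = "weyl_vector L0 ws f"
  have "((\<lambda>x. char_at ?w Z * ((\<Sum>l. 1 / fact l * Phi_power_coeff L0 ws f l x) * char_at x Z))
      has_sum Borcherds_product L0 ws f Z) (Q_monoid L0)"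
    unfolding Borcherds_product_def unordered_prod_eqI[OF s(1)]
    by (intro has_sum_cmult_right has_sum_exp_coeff s)
  then have "((\<lambda>x. Psi_coeff L0 ws f (?w + x) * char_at (?w + x) Z)
      has_sum Borcherds_product L0 ws f Z) (Q_monoid L0)"
    by (rule iffD1[OF has_sum_cong, rotated])
      (simp add: Psi_coeff_def shifted_Q_def char_at_add algebra_simps)
  then show "((\<lambda>x. Psi_coeff L0 ws f x * char_at x Z) has_sum Borcherds_product L0 ws f Z) (shifted_Q L0 ws f)"
    unfolding shifted_Q_def by (subst has_sum_reindex) (auto simp: o_def)
qed

end

section \<open>Uniqueness of the expansion\<close>

text \<open>Separates real from imaginary parts: for fixed \<open>Y\<close>, an expansion becomes an
  exponential sum in the real parts \<open>X\<close>.\<close>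

fun point_over :: "real \<times> real \<times> 'a \<Rightarrow> real \<times> real \<times> 'a \<Rightarrow> 'a point" where
  "point_over (x1, x2, x) (y1, y2, y) = (Complex x1 y1, Complex x2 y2, x, y)"

lemma Im_point_over [simp]: "Im_point (point_over X Y) = Y"
  by (cases X; cases Y) simp

lemma char_at_point_over:
  fixes X :: "real \<times> real \<times> 'a::real_inner"
  shows "char_at x (point_over X Y) = char_at x (point_over 0 Y) * ee (of_real (real_pairing x X))"
  by (cases x; cases X; cases Y)
    (simp add: zero_prod_def Complex_eq algebra_simps flip: ee_add)

text \<open>The pairing is nondegenerate: \<open>(a, c, - b)\<close> pairs with \<open>x\<close> to
  the squared length of \<open>x\<close>, and it remains to rescale. The value 1/2 is the one
  required to annihilate a coefficient.\<close>

lemma exists_pairing_half: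
  fixes x :: "'a::real_inner idx"
  assumes "x \<noteq> 0"
  shows "\<exists>X. real_pairing x X = 1 / 2"
proof -
  obtain a b c where x: "x = (a, b, c)"
    by (cases x)
  define r where "r = real_pairing x (a, c, - b)"
  have r: "r = a\<^sup>2 + c\<^sup>2 + inner b b"
    by (simp add: r_def x power2_eq_square)
  have "r \<noteq> 0"
  proof
    assume "r = 0"
    then have "a\<^sup>2 + c\<^sup>2 = 0 \<and> inner b b = 0"
      unfolding r using inner_ge_zero[of b] by (subst (asm) add_nonneg_eq_0_iff) auto
    then show False
      using assms by (simp add: x zero_prod_def sum_power2_eq_zero_iff)
  qed
  then have "real_pairing x ((1 / (2 * r)) *\<^sub>R (a, c, - b)) = 1 / 2"
    unfolding real_pairing_scaleR_right r_def[symmetric] by simp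
  then show ?thesis
    by blast
qed

text \<open>The difference of the two expansions is an exponential sum in \<open>X\<close> that
  vanishes identically, so its coefficients are bounded by 0.\<close>

lemma expansion_unique:
  fixes g g' :: "'a::real_inner idx \<Rightarrow> complex"
  assumes g: "\<And>X. ((\<lambda>x. g x * char_at x (point_over X Y)) has_sum G X) A"
    and g': "\<And>X. ((\<lambda>x. g' x * char_at x (point_over X Y)) has_sum G X) A"
    and x0: "x0 \<in> A"
  shows "g x0 = g' x0"
proof -
  define c where "c x = (g x - g' x) * char_at x (point_over 0 Y)" for x
  have c: "((\<lambda>x. c x * ee (of_real (real_pairing x X))) has_sum 0) A" for X
  proof -
    have "((\<lambda>x. g x * char_at x (point_over X Y) + - (g' x * char_at x (point_over X Y))) has_sum G X + - G X) A"
      by (intro has_sum_add has_sum_uminusI g g')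
    then show ?thesis
      by (simp add: c_def char_at_point_over[of _ X] algebra_simps)
  qed
  have "norm (c x0) \<le> 0"
  proof (rule norm_coeff_le_exponential_sum[OF _ x0 real_pairing_add_right c])
    have "(\<lambda>x. c x * ee (of_real (real_pairing x 0))) summable_on A"
      by (rule has_sum_imp_summable[OF c])
    moreover have "real_pairing x 0 = 0" for x :: "'a idx"
      using real_pairing_scaleR_right[of x 0 0] by simp
    ultimately show "(\<lambda>x. norm (c x)) summable_on A"
      by (simp add: summable_on_iff_abs_summable_on_complex)
    show "\<exists>X. real_pairing x X - real_pairing x0 X = 1 / 2" if "x \<noteq> x0" for x
      using exists_pairing_half[of "x - x0"] that real_pairing_add[of "x - x0" x0] by (auto simp: algebra_simps)
  qed simp
  moreover have "char_at x0 (point_over 0 Y) \<noteq> 0"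
    using norm_char_at[of x0 "point_over 0 Y"] by (metis exp_not_eq_zero norm_zero)
  ultimately show ?thesis
    by (simp add: c_def)
qed

section \<open>Scaling within the Weyl chamber\<close>

lemma quad_Y_scaleR: "quad_Y (r *\<^sub>R Y) = r\<^sup>2 * quad_Y Y"
  by (cases Y) (simp add: quad_def power2_eq_square algebra_simps)

text \<open>The cone and the walls are invariant under positive scaling, so the ray through
  \<open>Y\<close> is a connected set off the walls and stays in one component. This gives access to
  chamber points with large \<open>quad_Y\<close>, where convergence is known.\<close>

lemma Weyl_chamber_scaleR:
  fixes W :: "(real \<times> real \<times> 'a::euclidean_space) set"
  assumes W: "W \<in> components (positive_cone - walls L0 f)" and Y: "Y \<in> W" and r: "r > 0"
  shows "r *\<^sub>R Y \<in> W"
proof -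
  let ?T = "(\<lambda>r. r *\<^sub>R Y) ` {0<..}"
  have Y': "Y \<in> positive_cone - walls L0 f"
    using W Y in_components_subset by blast
  have "r *\<^sub>R Y \<in> positive_cone - walls L0 f" if "r > 0" for r
  proof
    show "r *\<^sub>R Y \<in> positive_cone"
      using Y' that by (simp add: positive_cone_def quad_Y_scaleR)
    show "r *\<^sub>R Y \<notin> walls L0 f"
      using Y' that by (auto simp: walls_def real_pairing_scaleR_right simp del: scaleR_Pair)
  qed
  then have "?T \<subseteq> positive_cone - walls L0 f"
    by auto
  moreover have "connected ?T"
    by (intro connected_continuous_image continuous_intros) simp
  moreover have "Y \<in> ?T"
    by (rule image_eqI[of _ _ 1]) auto
  then have "W \<inter> ?T \<noteq> {}"
    using Y by blast
  ultimately have "?T \<subseteq> W"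
    using components_maximal[OF W] by blast
  then show ?thesis
    using r by blast
qed

theorem theorem3p2:
  fixes n :: nat
    and L0 :: "'a::euclidean_space set"
    and ws :: "'a list"
    and \<rho> :: "mp2 \<Rightarrow> 'a ambient set \<Rightarrow> 'a ambient set \<Rightarrow> complex"
    and F :: "'a ambient set \<Rightarrow> complex \<Rightarrow> complex"
    and f :: "'a ambient set \<Rightarrow> real \<Rightarrow> int"
    and W :: "(real \<times> real \<times> 'a) set"
  assumes "n \<ge> 3" and "DIM('a) = n - 2"
    and "even_posdef_lattice L0"
    and "weil_representation 2 n bil_L (lat_L L0) \<rho>"
    and "weakly_holomorphic_form bil_L (lat_L L0) \<rho> (2 - int n) F"
    and "has_fourier_coeffs bil_L (lat_L L0) F (\<lambda>\<gamma> m. of_int (f \<gamma> m))"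
    and "rational_basis L0 ws"
    and "compatible_Weyl_chamber L0 ws f W"
  shows
    "(\<forall>x\<in>Q_monoid L0.
        (\<forall>l. finite {xs \<in> decompositions L0 l x. prod_list (map (Phi_coeff L0 ws f) xs) \<noteq> 0}) \<and>
        finite {l. Phi_power_coeff L0 ws f l x \<noteq> 0})
     \<and>
     (\<exists>R. \<forall>Z. Im_point Z \<in> W \<and> quad_Y (Im_point Z) > R \<longrightarrow> Z \<in> convergence_domain L0 ws f W)
     \<and>
     (\<forall>Z\<in>convergence_domain L0 ws f W.
        \<exists>p. has_unordered_prod (product_factor L0 f Z) p (pos_Q L0 ws))
     \<and>
     is_Fourier_expansion (shifted_Q L0 ws f) (convergence_domain L0 ws f W)
       (Borcherds_product L0 ws f) (Psi_coeff L0 ws f)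
     \<and>
     (\<forall>g. is_Fourier_expansion (shifted_Q L0 ws f) (convergence_domain L0 ws f W)
             (Borcherds_product L0 ws f) g \<longrightarrow>
          (\<forall>x. Psi_coeff L0 ws f x = g x))"
proof -
  note L0 = assms(3) and \<rho> = assms(4) and F = assms(5) and fourier = assms(6)
  let ?Q = "Q_monoid L0" and ?D = "convergence_domain L0 ws f W"
  have L: "is_lattice L0"
    using L0 by (simp add: even_posdef_lattice_def)
  have W: "W \<in> components (positive_cone - walls L0 f)"
    and W_pos: "\<And>x Y. x \<in> pos_Q L0 ws \<Longrightarrow> mult_at L0 f x \<noteq> 0 \<Longrightarrow> Y \<in> W \<Longrightarrow> real_pairing x Y > 0"
    using assms(8) by (auto simp: compatible_Weyl_chamber_def)
  obtain m0 where m0: "\<And>b m. b \<in> dual_lattice inner L0 \<Longrightarrow> complex_of_int (f (disc_class L0 b) m) \<noteq> 0 \<Longrightarrow> m0 \<le> m"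
    using fourier_coeffs_lower_bound[OF L0 fourier] by blast
  have chamber: "chamber_point L0 ws f Y m0" if "Y \<in> W" for Y
  proof
    show "Y \<in> positive_cone"
      using that W in_components_subset by blast
    show "m0 \<le> disc x" if "x \<in> ?Q" "mult_at L0 f x \<noteq> 0" for x
      using that by (cases x) (auto simp: Q_monoid_def coeff_at_def intro: m0)
  qed (use L W_pos that in auto)
  \<comment> \<open>The finiteness claims do not mention a point, so any single point of the chamber
    serves to prove them.\<close>
  obtain Y0 where Y0: "Y0 \<in> W"
    using in_components_nonempty[OF W] by blast
  \<comment> \<open>From \<open>n \<ge> 3\<close> the weight is negative, as the coefficient bound
    requires.\<close>
  obtain C K where CK: "C \<ge> 0" "K \<ge> 0"
    and coeff: "\<And>b m. b \<in> dual_lattice inner L0 \<Longrightarrow> norm (complex_of_int (f (disc_class L0 b) m)) \<le> C * exp (K * sqrt \<bar>m\<bar>)"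
    using fourier_coeff_bound[OF L0 \<rho> F _ fourier] assms(1) by auto
  have mult_bound: "real_of_int \<bar>mult_at L0 f x\<bar> \<le> C * exp (K * sqrt \<bar>disc x\<bar>)" if "x \<in> ?Q" for x
    using that coeff by (cases x) (auto simp: Q_monoid_def coeff_at_def)
  have converges: "Z \<in> ?D" if Z: "Im_point Z \<in> W" "quad_Y (Im_point Z) > K\<^sup>2" for Z
  proof -
    have "K \<le> sqrt (quad_Y (Im_point Z))"
      using Z(2) CK by (simp add: real_le_rsqrt)
    then show ?thesis
      using chamber_point.summable_on_characters[OF chamber[OF Z(1)] mult_bound CK _ refl] Z(1)
      by (simp add: convergence_domain_def)
  qed
  have expansion: "\<exists>p. has_unordered_prod (product_factor L0 f Z) p (pos_Q L0 ws)"
    "((\<lambda>x. Psi_coeff L0 ws f x * char_at x Z) has_sum Borcherds_product L0 ws f Z) (shifted_Q L0 ws f)"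
    if "Z \<in> ?D" for Z
    using that chamber_point.has_unordered_prod_and_expansion[OF chamber refl]
    by (auto simp: convergence_domain_def)
  have Psi_expansion: "is_Fourier_expansion (shifted_Q L0 ws f) ?D (Borcherds_product L0 ws f) (Psi_coeff L0 ws f)"
    using expansion(2) by (simp add: is_Fourier_expansion_def Psi_coeff_def)
  have "Psi_coeff L0 ws f x = g x"
    if g: "is_Fourier_expansion (shifted_Q L0 ws f) ?D (Borcherds_product L0 ws f) g" for g x
  proof (cases "x \<in> shifted_Q L0 ws f")
    case True
    have q0: "quad_Y Y0 > 0"
      using chamber[OF Y0] by (simp add: chamber_point_def positive_cone_def)
    \<comment> \<open>Chosen so that \<open>quad_Y (r *\<^sub>R Y0)\<close> is the square of
      \<open>K + 1\<close> and exceeds that of \<open>K\<close>: then every point over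
      \<open>r *\<^sub>R Y0\<close>, whatever its real part, lies in the convergence domain.\<close>
    define r where "r = (K + 1) / sqrt (quad_Y Y0)"
    have r: "r > 0"
      using q0 CK by (simp add: r_def)
    have "quad_Y (r *\<^sub>R Y0) = (K + 1)\<^sup>2"
      using q0 by (simp add: quad_Y_scaleR r_def power_divide)
    moreover have "K\<^sup>2 < (K + 1)\<^sup>2"
      using CK by (intro power_strict_mono) auto
    ultimately have D: "point_over X (r *\<^sub>R Y0) \<in> ?D" for X
      using converges[of "point_over X (r *\<^sub>R Y0)"] Weyl_chamber_scaleR[OF W Y0 r]
      by (simp del: scaleR_Pair)
    show ?thesis
      by (rule expansion_unique[where Y = "r *\<^sub>R Y0", OF _ _ True])
        (use D g Psi_expansion in \<open>auto simp: is_Fourier_expansion_def simp del: scaleR_Pair\<close>)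
  next
    case False
    then show ?thesis
      using g unfolding is_Fourier_expansion_def Psi_coeff_def by metis
  qed
  then show ?thesis
    using converges expansion(1) Psi_expansion
      chamber_point.finite_nonzero_decompositions[OF chamber[OF Y0]]
      chamber_point.finite_nonzero_Phi_power[OF chamber[OF Y0]]
    by blast
qed

end
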